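(* For $\mathcal T\in\mathbb T$ let $\mathcal T_*\succ\mathcal T$ be a uniform red-refinement of $\mathcal T$ and $\mathcal T_{**}\succ\mathcal T_*$ a uniform red-refinement of $\mathcal T_*$. For $\nu\in N^0_{\mathcal T}$ define $$\theta_{\mathcal T,\nu}:=\tfrac{2^{d+2}}{d+2}\big(2^d\,\mathbb 1_{\omega_{\mathcal T_{**},\nu}}-\mathbb 1_{\omega_{\mathcal T_*,\nu}}\big),\qquad\psi_{\mathcal T,\nu}:=\phi_{\mathcal T,\nu}+\theta_{\mathcal T,\nu}.$$ Then, with constants independent of $\mathcal T\in\mathbb T$, $$|\langle\phi_{\mathcal T,\nu},\psi_{\mathcal T,\nu'}\rangle_{L_2(\Omega)}|\eqsim\delta_{\nu\nu'}\|\phi_{\mathcal T,\nu}\|_{L_2(\Omega)}\|\psi_{\mathcal T,\nu'}\|_{L_2(\Omega)}\quad(\nu,\nu'\in N^0_{\mathcal T}),$$ $\operatorname{supp}\psi_{\mathcal T,\nu}=\omega_{\mathcal T,\nu}$ for $\nu\in N^0_{\mathcal T}$, and $$\langle\psi_{\mathcal T,\nu},\phi_{\mathcal T,\nu'}\rangle_{L_2(\Omega)}=\delta_{\nu\nu'}(d+1)^{-1}|\omega_{\mathcal T,\nu}|\qquad(\nu,\nu'\in N^0_{\mathcal T}).$$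
   Context: $\Omega\subset\mathbb R^d$ is a bounded polytopal domain and $\gamma\subset\partial\Omega$ is measurable, closed and possibly empty. $\mathbb T$ is a family of conforming partitions $\mathcal T$ of $\Omega$ into closed uniformly shape regular $d$-simplices; neighbouring simplices (those with $T\cap T'\neq\emptyset$) have uniformly comparable sizes (a consequence of conformity and shape regularity for $d>1$, imposed for $d=1$). For every $\mathcal T$, $\gamma$ is the (possibly empty) union of $(d-1)$-faces of simplices $T\in\mathcal T$. $N^0_{\mathcal T}$ is the set of vertices of $\mathcal T$ not on $\gamma$. For a partition $\mathcal S$ ($=\mathcal T,\mathcal T_*,\mathcal T_{**}$) and a vertex $\nu$, $\omega_{\mathcal S,\nu}:=\bigcup\{T\in\mathcal S:\nu\in T\}$, and $|\omega|$ denotes volume. $\mathbb 1_K$ is the indicator function of $K$. $\{\phi_{\mathcal T,\nu}:\nu\in N^0_{\mathcal T}\}$ is the nodal basis, $\phi_{\mathcal T,\nu}(\nu')=\delta_{\nu\nu'}$, of the space $\{u\in H^1_{0,\gamma}(\Omega):u|_T\in\mathcal P_1\ (T\in\mathcal T)\}$, where $H^1_{0,\gamma}(\Omega)$ consists of the $H^1(\Omega)$-functions vanishing on $\gamma$. Uniform red-refinement: every simplex $T$ is subdivided into $2^d$ subsimplices of equal volume; for each vertex $\nu$ of $T$ exactly one of them contains $\nu$, and it is the image of $T$ under the homothety with centre $\nu$ and ratio $1/2$ (the remaining subsimplices are not uniquely determined for $d\ge3$, but are not relevant here). $\lambda\eqsim\mu$ means that $c\mu\le\lambda\le C\mu$ with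 constants $c,C>0$ independent of $\mathcal T\in\mathbb T$ and of the vertices. *)

theory Defs
  imports "HOL-Analysis.Analysis"
begin

text \<open>The ambient space \<open>\<real>\<^sup>d\<close> is an arbitrary Euclidean space \<open>'a\<close>, with \<open>d = DIM('a)\<close>.\<close>

section \<open>Domains and partitions\<close>

text \<open>Finite unions of polytopes are compact, so such domains are open and bounded.
  Taking the interior of the union excludes slit domains.\<close>

definition polytopal_domain :: "'a::euclidean_space set \<Rightarrow> bool" where
  "polytopal_domain \<Omega> \<longleftrightarrow>
     \<Omega> \<noteq> {} \<and> connected \<Omega> \<and>
     (\<exists>P. finite P \<and> (\<forall>p\<in>P. polytope p) \<and> \<Omega> = interior (\<Union>P))"

text \<open>Conformity is part of \<open>triangulation\<close>: two members meet in a (possibly empty) common face.\<close>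

definition conforming_partition :: "'a::euclidean_space set \<Rightarrow> 'a set set \<Rightarrow> bool" where
  "conforming_partition \<Omega> \<T> \<longleftrightarrow>
     triangulation \<T> \<and> (\<forall>T\<in>\<T>. int DIM('a) simplex T) \<and> \<Union>\<T> = closure \<Omega>"

definition uniformly_shape_regular :: "'a::euclidean_space set set set \<Rightarrow> bool" where
  "uniformly_shape_regular \<TT> \<longleftrightarrow>
     (\<exists>\<kappa>>0. \<forall>\<T>\<in>\<TT>. \<forall>T\<in>\<T>. \<exists>x. cball x (diameter T / \<kappa>) \<subseteq> T)"

definition neighbours_uniformly_comparable :: "'a::euclidean_space set set set \<Rightarrow> bool" where
  "neighbours_uniformly_comparable \<TT> \<longleftrightarrow>
     (\<exists>\<kappa>>0. \<forall>\<T>\<in>\<TT>. \<forall>T\<in>\<T>. \<forall>T'\<in>\<T>. T \<inter> T' \<noteq> {} \<longrightarrow> diameter T \<le> \<kappa> * diameter T')"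

definition union_of_facets :: "'a::euclidean_space set set \<Rightarrow> 'a set \<Rightarrow> bool" where
  "union_of_facets \<T> \<gamma> \<longleftrightarrow> (\<exists>\<F>. (\<forall>F\<in>\<F>. \<exists>T\<in>\<T>. F facet_of T) \<and> \<gamma> = \<Union>\<F>)"

definition free_vertices :: "'a::euclidean_space set \<Rightarrow> 'a set set \<Rightarrow> 'a set" where
  "free_vertices \<gamma> \<T> = {\<nu>. \<exists>T\<in>\<T>. \<nu> extreme_point_of T} - \<gamma>"

definition patch :: "'a set set \<Rightarrow> 'a \<Rightarrow> 'a set" where
  "patch \<S> \<nu> = \<Union>{T \<in> \<S>. \<nu> \<in> T}"

section \<open>Uniform red-refinement\<close>

text \<open>Only the members at the vertices of \<open>T\<close> are prescribed; the remaining ones are any simplices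
  of the right volume that complete the subdivision. The resulting partition of the domain is
  not required to be conforming.\<close>

definition red_subdivision :: "'a::euclidean_space set \<Rightarrow> 'a set set \<Rightarrow> bool" where
  "red_subdivision T R \<longleftrightarrow>
     finite R \<and> card R = 2 ^ DIM('a) \<and> \<Union>R = T \<and>
     (\<forall>K\<in>R. int DIM('a) simplex K \<and> measure lebesgue K = measure lebesgue T / 2 ^ DIM('a)) \<and>
     (\<forall>K\<in>R. \<forall>K'\<in>R. K \<noteq> K' \<longrightarrow> interior K \<inter> interior K' = {}) \<and>
     (\<forall>\<nu>. \<nu> extreme_point_of T \<longrightarrow>
        {K \<in> R. \<nu> \<in> K} = {(\<lambda>x. \<nu> + (1/2) *\<^sub>R (x - \<nu>)) ` T})"

definition red_refinement :: "'a::euclidean_space set set \<Rightarrow> 'a set set \<Rightarrow> bool" where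
  "red_refinement \<T> \<S> \<longleftrightarrow>
     (\<exists>R. (\<forall>T\<in>\<T>. red_subdivision T (R T)) \<and> \<S> = (\<Union>T\<in>\<T>. R T))"

section \<open>Function spaces\<close>

definition square_integrable_on :: "('a::euclidean_space \<Rightarrow> real) \<Rightarrow> 'a set \<Rightarrow> bool" where
  "square_integrable_on u \<Omega> \<longleftrightarrow>
     set_borel_measurable lebesgue \<Omega> u \<and> set_integrable lebesgue \<Omega> (\<lambda>x. (u x)\<^sup>2)"

definition L2_inner :: "'a::euclidean_space set \<Rightarrow> ('a \<Rightarrow> real) \<Rightarrow> ('a \<Rightarrow> real) \<Rightarrow> real" where
  "L2_inner \<Omega> u v = (LINT x:\<Omega>|lebesgue. u x * v x)"

definition L2_norm :: "'a::euclidean_space set \<Rightarrow> ('a \<Rightarrow> real) \<Rightarrow> real" where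
  "L2_norm \<Omega> u = sqrt (L2_inner \<Omega> u u)"

definition supp_on :: "'a::topological_space set \<Rightarrow> ('a \<Rightarrow> real) \<Rightarrow> 'a set" where
  "supp_on \<Omega> u = closure {x \<in> \<Omega>. u x \<noteq> 0}"

primrec Ck :: "nat \<Rightarrow> ('a::euclidean_space \<Rightarrow> real) \<Rightarrow> bool" where
  "Ck 0 f \<longleftrightarrow> continuous_on UNIV f"
| "Ck (Suc k) f \<longleftrightarrow>
     (\<forall>x. f differentiable (at x)) \<and> (\<forall>b\<in>Basis. Ck k (\<lambda>x. frechet_derivative f (at x) b))"

definition test_function :: "'a::euclidean_space set \<Rightarrow> ('a \<Rightarrow> real) \<Rightarrow> bool" where
  "test_function \<Omega> \<eta> \<longleftrightarrow>
     (\<forall>k. Ck k \<eta>) \<and> compact (supp_on UNIV \<eta>) \<and> supp_on UNIV \<eta> \<subseteq> \<Omega>"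

definition weak_partial ::
    "'a::euclidean_space set \<Rightarrow> 'a \<Rightarrow> ('a \<Rightarrow> real) \<Rightarrow> ('a \<Rightarrow> real) \<Rightarrow> bool" where
  "weak_partial \<Omega> b u g \<longleftrightarrow>
     (\<forall>\<eta>. test_function \<Omega> \<eta> \<longrightarrow>
        L2_inner \<Omega> u (\<lambda>x. frechet_derivative \<eta> (at x) b) = - L2_inner \<Omega> g \<eta>)"

definition H1 :: "'a::euclidean_space set \<Rightarrow> ('a \<Rightarrow> real) set" where
  "H1 \<Omega> = {u. square_integrable_on u \<Omega> \<and>
              (\<forall>b\<in>Basis. \<exists>g. square_integrable_on g \<Omega> \<and> weak_partial \<Omega> b u g)}"

text \<open>The \<open>H\<^sup>1\<close> functions that vanish on \<open>\<gamma>\<close> and are affine on every \<open>T \<in> \<T>\<close>. As usual for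
  Lagrange elements, a member is given by its representative that is continuous up to the boundary:
  point values at the vertices refer to it, and its trace on \<open>\<gamma>\<close> is its restriction to \<open>\<gamma>\<close>.\<close>

definition fe_space ::
    "'a::euclidean_space set \<Rightarrow> 'a set \<Rightarrow> 'a set set \<Rightarrow> ('a \<Rightarrow> real) set" where
  "fe_space \<Omega> \<gamma> \<T> =
     {u \<in> H1 \<Omega>. continuous_on (closure \<Omega>) u \<and> (\<forall>x\<in>\<gamma>. u x = 0) \<and>
        (\<forall>T\<in>\<T>. \<exists>a b. \<forall>x\<in>T. u x = a \<bullet> x + b)}"

text \<open>This determines \<open>\<phi> \<nu>\<close> on \<open>closure \<Omega>\<close> for every free vertex \<open>\<nu>\<close>; values elsewhere are irrelevant.\<close>

definition nodal_basis ::
    "'a::euclidean_space set \<Rightarrow> 'a set \<Rightarrow> 'a set set \<Rightarrow> ('a \<Rightarrow> 'a \<Rightarrow> real) \<Rightarrow> bool" where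
  "nodal_basis \<Omega> \<gamma> \<T> \<phi> \<longleftrightarrow>
     (\<forall>\<nu>\<in>free_vertices \<gamma> \<T>. \<phi> \<nu> \<in> fe_space \<Omega> \<gamma> \<T> \<and>
        (\<forall>\<nu>'\<in>free_vertices \<gamma> \<T>. \<phi> \<nu> \<nu>' = of_bool (\<nu> = \<nu>')))"

definition theta :: "'a::euclidean_space set set \<Rightarrow> 'a set set \<Rightarrow> 'a \<Rightarrow> 'a \<Rightarrow> real" where
  "theta \<T>\<^sub>1 \<T>\<^sub>2 \<nu> x =
     2 ^ (DIM('a) + 2) / real (DIM('a) + 2) *
       (2 ^ DIM('a) * indicator (patch \<T>\<^sub>2 \<nu>) x - indicator (patch \<T>\<^sub>1 \<nu>) x)"

definition psi ::
    "('a::euclidean_space \<Rightarrow> 'a \<Rightarrow> real) \<Rightarrow> 'a set set \<Rightarrow> 'a set set \<Rightarrow> 'a \<Rightarrow> 'a \<Rightarrow> real" where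
  "psi \<phi> \<T>\<^sub>1 \<T>\<^sub>2 \<nu> x = \<phi> \<nu> x + theta \<T>\<^sub>1 \<T>\<^sub>2 \<nu> x"

end

theory Submission
  imports Defs
begin

text \<open>Let \<open>T\<close> be a simplex with vertex \<open>\<nu>\<close> and barycentric coordinate \<open>l\<close> belonging to \<open>\<nu>\<close>.
  The set \<open>{l \<ge> s}\<close> is the homothetic copy of \<open>T\<close> with centre \<open>\<nu>\<close> and ratio \<open>1 - s\<close>, and to first
  order in \<open>s\<close> it carries the whole integral of \<open>l * g\<close> for affine \<open>g\<close>. Differentiating the
  transformation formula for this homothety at \<open>s = 0\<close> yields
  \<open>(d + 2) * (\<integral> l * g) = (\<integral> g) + g \<nu> * (\<integral> l)\<close>, and for \<open>g = 1\<close> the value \<open>\<bar>T\<bar> / (d + 1)\<close> of \<open>\<integral> l\<close>.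
  The integrals of \<open>g\<close> over the copies of ratio \<open>1/2\<close> and \<open>1/4\<close> are known as well, and in
  the integral of \<open>\<psi> * g\<close> over \<open>T\<close> the unknown \<open>\<integral> g\<close> cancels, leaving \<open>g \<nu> * \<bar>T\<bar> / (d + 1)\<close>.
  Summation over the patch gives the biorthogonality. One side of the norm equivalence is then the
  Cauchy-Schwarz inequality; the other follows from uniform bounds on \<open>\<phi>\<close> and \<open>\<psi>\<close>.
  For the support, \<open>\<psi>\<close> vanishes inside \<open>T\<close> at most on four hyperplanes.\<close>

section \<open>Homotheties and affine moments of simplices\<close>

abbreviation homothety :: "'a::real_vector \<Rightarrow> real \<Rightarrow> 'a \<Rightarrow> 'a" where
  "homothety v c \<equiv> (\<lambda>x. v + c *\<^sub>R (x - v))"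

lemma inj_homothety: "c \<noteq> 0 \<Longrightarrow> inj (homothety v c)"
  by (auto simp: inj_def)

lemma homothety_homothety: "homothety v c (homothety v c' x) = homothety v (c * c') x"
  by (simp add: algebra_simps)

lemma compact_homothety:
  fixes S :: "'a::real_normed_vector set"
  assumes "compact S"
  shows "compact (homothety v c ` S)"
  by (intro compact_continuous_image continuous_intros assms)

lemma homothety_image_subset:
  assumes "convex S" "v \<in> S" "0 \<le> c" "c \<le> 1"
  shows "homothety v c ` S \<subseteq> S"
proof clarify
  fix x assume "x \<in> S"
  then have "(1 - c) *\<^sub>R v + c *\<^sub>R x \<in> S"
    using assms by (intro convexD) auto
  then show "homothety v c x \<in> S"
    by (simp add: algebra_simps)
qed

lemma affine_homothety:
  fixes a :: "'a::real_inner"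
  shows "a \<bullet> homothety v c x + b = (1 - c) * (a \<bullet> v + b) + c * (a \<bullet> x + b)"
  by (simp add: inner_simps algebra_simps)

text \<open>Affine change of variables for \<open>lborel\<close>; as the homothety is injective, the
  indicator of the copy pulls back to the indicator of \<open>S\<close>.\<close>

lemma set_integral_homothety:
  fixes f :: "'a::euclidean_space \<Rightarrow> real"
  assumes c: "c > 0" and S: "compact S" and f: "f \<in> borel_measurable borel"
  shows "(LINT x:homothety v c ` S|lborel. f x)
           = c ^ DIM('a) * (LINT x:S|lborel. f (homothety v c x))"
proof -
  let ?g = "\<lambda>x. indicator (homothety v c ` S) x *\<^sub>R f x"
  \<comment> \<open>Translation part of the homothety, which brings it to the form
    \<open>t + c *\<^sub>R x\<close> of \<open>lborel_affine\<close>.\<close>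
  let ?t = "(1 - c) *\<^sub>R v"
  have h: "?t + c *\<^sub>R x = homothety v c x" for x
    by (simp add: algebra_simps)
  have mS: "homothety v c ` S \<in> sets borel"
    by (intro borel_compact compact_homothety S)
  have mg: "?g \<in> borel_measurable borel"
    using mS f by measurable
  have mh: "(\<lambda>x. ?t + c *\<^sub>R x) \<in> lborel \<rightarrow>\<^sub>M borel"
    by measurable
  have "(LINT x|lborel. ?g x)
      = (LINT x|density (distr lborel borel (\<lambda>x. ?t + c *\<^sub>R x)) (\<lambda>_. ennreal (\<bar>c\<bar> ^ DIM('a))). ?g x)"
    using c by (subst lborel_affine[where t = "?t" and c = c]) auto
  also have "\<dots> = (LINT x|distr lborel borel (\<lambda>x. ?t + c *\<^sub>R x). (c ^ DIM('a)) *\<^sub>R ?g x)"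
    using c mg by (subst integral_density) auto
  also have "\<dots> = (LINT x|lborel. (c ^ DIM('a)) *\<^sub>R ?g (?t + c *\<^sub>R x))"
    using mg by (subst integral_distr) (auto intro: mh)
  also have "\<dots> = (LINT x|lborel. c ^ DIM('a) *\<^sub>R (indicator S x *\<^sub>R f (homothety v c x)))"
  proof (rule Bochner_Integration.integral_cong[OF refl])
    fix x
    have "homothety v c x \<in> homothety v c ` S \<longleftrightarrow> x \<in> S"
      using inj_homothety[of c v] c by (auto simp: inj_image_mem_iff)
    then show "(c ^ DIM('a)) *\<^sub>R ?g (?t + c *\<^sub>R x)
        = c ^ DIM('a) *\<^sub>R (indicator S x *\<^sub>R f (homothety v c x))"
      unfolding h by (simp add: indicator_def)
  qed
  finally show ?thesis
    by (simp add: set_lebesgue_integral_def)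
qed

lemma set_integral_const_compact:
  fixes k :: real
  assumes "compact S"
  shows "(LINT x:S|lborel. k) = k * measure lborel S"
proof -
  have "S \<in> sets lborel" "emeasure lborel S \<noteq> \<infinity>"
    using assms emeasure_compact_finite[OF assms] by (auto simp: borel_compact)
  then show ?thesis
    by (simp add: set_integral_const)
qed

lemma measure_homothety:
  fixes S :: "'a::euclidean_space set"
  assumes "c > 0" "compact S"
  shows "measure lborel (homothety v c ` S) = c ^ DIM('a) * measure lborel S"
  using set_integral_homothety[OF assms, of "\<lambda>_. 1" v]
  by (simp add: set_integral_const_compact compact_homothety assms)

lemma set_integrable_compact:
  fixes f :: "'a::euclidean_space \<Rightarrow> real"
  assumes "compact S" "continuous_on S f"
  shows "set_integrable lborel S f"
  unfolding set_integrable_def using borel_integrable_compact[OF assms] .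

text \<open>Write \<open>x\<close> as a convex combination of the apex \<open>v\<close> and a point
  of the base. The weight of \<open>v\<close> is exactly the coordinate of \<open>x\<close>, so if
  it is at least \<open>s\<close>, the share \<open>s\<close> of \<open>v\<close> can be split off
  and the rest rescaled. Contrapositively, the coordinate is below \<open>s\<close> outside the
  copy.\<close>

lemma mem_homothety_cone:
  fixes v :: "'a::real_inner"
  assumes T: "T = convex hull (insert v W)" and W: "W \<noteq> {}"
    and lv: "a \<bullet> v + b = 1" and lW: "\<And>w. w \<in> W \<Longrightarrow> a \<bullet> w + b = 0"
    and x: "x \<in> T" and s: "0 < s" "s < 1" and xs: "s \<le> a \<bullet> x + b"
  shows "x \<in> homothety v (1 - s) ` T"
proof -
  obtain u u' y where u: "0 \<le> u" "0 \<le> u'" "u + u' = 1" and y: "y \<in> convex hull W"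
    and xy: "x = u *\<^sub>R v + u' *\<^sub>R y"
    using x W unfolding T by (auto simp: convex_hull_insert)
  have "convex {z. a \<bullet> z = - b}"
    by (rule convex_hyperplane)
  moreover have "W \<subseteq> {z. a \<bullet> z = - b}"
    using lW by (auto simp: eq_neg_iff_add_eq_0)
  ultimately have "y \<in> {z. a \<bullet> z = - b}"
    using y hull_minimal by blast
  then have "a \<bullet> x + b = u * (a \<bullet> v) - u' * b + b"
    by (simp add: xy inner_simps)
  also have "\<dots> = u * (a \<bullet> v + b)"
    using u(3) by algebra
  finally have lx: "a \<bullet> x + b = u"
    by (simp add: lv)
  \<comment> \<open>The solution of \<open>x = s *\<^sub>R v + (1 - s) *\<^sub>R z\<close>, that is,
    the preimage of \<open>x\<close> under the homothety.\<close>
  define z where "z = ((u - s) / (1 - s)) *\<^sub>R v + (u' / (1 - s)) *\<^sub>R y"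
  have "z \<in> T"
    unfolding T z_def
  proof (intro convexD[OF convex_convex_hull])
    show "y \<in> convex hull insert v W"
      using y hull_mono[of W "insert v W" convex] by auto
    show "(u - s) / (1 - s) + u' / (1 - s) = 1"
      using s u by (simp add: add_divide_distrib[symmetric])
  qed (use s u xs lx hull_inc[of v "insert v W" convex] in auto)
  moreover have "x = homothety v (1 - s) z"
  proof -
    have "(1 - s) *\<^sub>R z = (u - s) *\<^sub>R v + u' *\<^sub>R y"
      using s by (simp add: z_def scaleR_add_right)
    then show ?thesis
      by (simp add: xy algebra_simps)
  qed
  ultimately show ?thesis
    by blast
qed

lemma affine_between_on_hull:
  fixes v :: "'a::real_inner"
  assumes T: "T = convex hull (insert v W)"
    and lv: "a \<bullet> v + b = 1" and lW: "\<And>w. w \<in> W \<Longrightarrow> a \<bullet> w + b = 0"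
    and x: "x \<in> T"
  shows "0 \<le> a \<bullet> x + b" "a \<bullet> x + b \<le> 1"
proof -
  have "insert v W \<subseteq> {x. - b \<le> a \<bullet> x} \<inter> {x. a \<bullet> x \<le> 1 - b}"
    using lv lW by fastforce
  moreover have "convex ({x. - b \<le> a \<bullet> x} \<inter> {x. a \<bullet> x \<le> 1 - b})"
    by (intro convex_Int convex_halfspace_le)
      (metis (no_types) convex_halfspace_ge)
  ultimately have "x \<in> {x. - b \<le> a \<bullet> x} \<inter> {x. a \<bullet> x \<le> 1 - b}"
    using x hull_minimal unfolding T by blast
  then show "0 \<le> a \<bullet> x + b" "a \<bullet> x + b \<le> 1"
    by auto
qed

text \<open>Comparing the integral over \<open>T\<close> with the one over its homothetic copy of ratio \<open>1 - s\<close>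
  leaves an error of order \<open>s\<^sup>2\<close>; the claim is the vanishing of the first-order term in \<open>s\<close>.\<close>

lemma integral_cone_mult_affine:
  fixes v a a' :: "'a::euclidean_space" and b b' :: real
  assumes T: "T = convex hull (insert v W)" and W: "finite W" "W \<noteq> {}"
    and lv: "a \<bullet> v + b = 1" and lW: "\<And>w. w \<in> W \<Longrightarrow> a \<bullet> w + b = 0"
  defines "l \<equiv> \<lambda>x. a \<bullet> x + b" and "g \<equiv> \<lambda>x. a' \<bullet> x + b'"
  shows "(DIM('a) + 2) * (LINT x:T|lborel. l x * g x)
    = (LINT x:T|lborel. g x) + g v * (LINT x:T|lborel. l x)"
proof -
  let ?d = "DIM('a)"
  have cT: "compact T"
    unfolding T using W by (intro finite_imp_compact_convex_hull) auto
  have vT: "v \<in> T" and convT: "convex T"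
    unfolding T by (auto intro: hull_inc)
  have cont: "continuous_on S l" "continuous_on S g" for S
    unfolding l_def g_def by (intro continuous_intros)+
  have int: "set_integrable lborel S f" if "compact S" "continuous_on UNIV f" for S :: "'a set" and f :: "'a \<Rightarrow> real"
    using that by (intro set_integrable_compact) (auto intro: continuous_on_subset)
  obtain G where G: "\<And>x. x \<in> T \<Longrightarrow> \<bar>g x\<bar> \<le> G" and G0: "G \<ge> 0"
  proof -
    have "bounded (g ` T)"
      by (intro compact_imp_bounded compact_continuous_image cont cT)
    then obtain B where "B > 0" "\<And>x. x \<in> T \<Longrightarrow> norm (g x) \<le> B"
      by (auto simp: bounded_pos)
    then show ?thesis
      using that[of B] by auto
  qed
  define J where "J = (LINT x:T|lborel. l x * g x)"
  define I where "I = (LINT x:T|lborel. l x)"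
  define K where "K = (LINT x:T|lborel. g x)"
  define \<mu> where "\<mu> = measure lborel T"
  \<comment> \<open>\<open>J + s * P + s\<^sup>2 * Q\<close> is the integral over \<open>T\<close>
    of the transformed product \<open>(s + (1 - s) * l) * (s * g v + (1 - s) * g)\<close>. Hence
    \<open>p s\<close> is the integral of \<open>l * g\<close> over the part of \<open>T\<close>
    outside the copy of ratio \<open>1 - s\<close>.\<close>
  define P where "P = K + g v * I - 2 * J"
  define Q where "Q = g v * (\<mu> - I) - (K - J)"
  define p where "p s = J - (1 - s) ^ ?d * (J + s * P + s\<^sup>2 * Q)" for s :: real
  \<comment> \<open>Outside the copy \<open>0 \<le> l < s\<close>, and the volume left there is the
    last factor. Both are of order \<open>s\<close>.\<close>
  have key: "\<bar>p s\<bar> \<le> s * G * (\<mu> * (1 - (1 - s) ^ ?d))" if s: "0 < s" "s < 1" for s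
  proof -
    let ?h = "homothety v (1 - s)"
    have cH: "compact (?h ` T)"
      by (rule compact_homothety[OF cT])
    have sub: "?h ` T \<subseteq> T"
      using s by (intro homothety_image_subset convT vT) auto
    have l_h: "l (?h x) = s + (1 - s) * l x" for x
      unfolding l_def affine_homothety lv by simp
    have g_h: "g (?h x) = s * g v + (1 - s) * g x" for x
      unfolding g_def affine_homothety by simp
    have "(LINT x:?h ` T|lborel. l x * g x) = (1 - s) ^ ?d * (LINT x:T|lborel. l (?h x) * g (?h x))"
      using s by (intro set_integral_homothety cT)
        (auto intro!: borel_measurable_continuous_onI continuous_intros cont)
    also have "(LINT x:T|lborel. l (?h x) * g (?h x))
      = (LINT x:T|lborel. (1 - s)\<^sup>2 * (l x * g x) + (s * (1 - s)) * g x + (s * (1 - s) * g v) * l x + s\<^sup>2 * g v)"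
      unfolding l_h g_h by (simp add: algebra_simps power2_eq_square)
    also have "\<dots> = (1 - s)\<^sup>2 * J + (s * (1 - s)) * K + (s * (1 - s) * g v) * I + s\<^sup>2 * g v * \<mu>"
      using cT by (simp add: set_integral_add int cT continuous_intros cont J_def K_def I_def \<mu>_def
          set_integral_const_compact)
    also have "\<dots> = J + s * P + s\<^sup>2 * Q"
      unfolding P_def Q_def by algebra
    finally have 1: "(LINT x:?h ` T|lborel. l x * g x) = (1 - s) ^ ?d * (J + s * P + s\<^sup>2 * Q)" .
    let ?D = "T - ?h ` T"
    have mD: "?D \<in> sets lborel"
      using cT cH by (auto simp: borel_compact)
    have iT: "set_integrable lborel T (\<lambda>x. l x * g x)"
      by (intro int cT continuous_intros cont)
    have iD: "set_integrable lborel ?D (\<lambda>x. l x * g x)"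
      by (rule set_integrable_subset[OF iT mD]) auto
    have "J = (LINT x:?h ` T \<union> ?D|lborel. l x * g x)"
      unfolding J_def using sub by (metis Un_Diff_cancel Un_absorb1)
    also have "\<dots> = (LINT x:?h ` T|lborel. l x * g x) + (LINT x:?D|lborel. l x * g x)"
      by (intro set_integral_Un iD int cH continuous_intros cont) auto
    finally have p: "p s = (LINT x:?D|lborel. l x * g x)"
      unfolding p_def 1 by simp
    have eD: "emeasure lborel ?D \<noteq> \<infinity>"
      using emeasure_compact_finite[OF cT] emeasure_mono[of ?D T lborel] cT
      by (auto simp: borel_compact top_unique)
    have bd: "\<bar>l x * g x\<bar> \<le> s * G" if "x \<in> ?D" for x
    proof -
      have "\<not> s \<le> l x"
        using mem_homothety_cone[OF T W(2) lv lW _ s] that unfolding l_def by blast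
      moreover have "0 \<le> l x"
        using affine_between_on_hull(1)[OF T lv lW] that unfolding l_def by blast
      ultimately show ?thesis
        using G[of x] that s by (auto simp: abs_mult intro!: mult_mono)
    qed
    have "\<bar>p s\<bar> \<le> (LINT x:?D|lborel. \<bar>l x * g x\<bar>)"
      unfolding p using set_integral_norm_bound[OF iD] by simp
    also have "\<dots> \<le> (LINT x:?D|lborel. s * G)"
    proof (rule set_integral_mono)
      show "set_integrable lborel ?D (\<lambda>x. s * G)"
        using mD eD by (simp add: set_integrable_def less_top)
    qed (use bd set_integrable_abs[OF iD] in auto)
    also have "\<dots> = s * G * measure lborel ?D"
      using mD eD by (simp add: set_integral_const)
    also have "measure lborel ?D = \<mu> - measure lborel (?h ` T)"
      unfolding \<mu>_def using cT cH sub emeasure_compact_finite[OF cT]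
      by (intro measure_Diff) (auto simp: borel_compact)
    also have "\<dots> = \<mu> * (1 - (1 - s) ^ ?d)"
      using s measure_homothety[OF _ cT, of "1 - s" v] by (simp add: \<mu>_def right_diff_distrib)
    finally show ?thesis .
  qed
  \<comment> \<open>As \<open>p 0 = 0\<close>, the quotient \<open>p s / s\<close> tends to this
    derivative, while \<open>key\<close> bounds it by a quantity tending to 0. So
    \<open>?d * J = P\<close>, which is the claim once \<open>2 * J\<close> is moved to the
    left.\<close>
  have "(p has_real_derivative (?d * J - P)) (at 0)"
    unfolding p_def by (auto intro!: derivative_eq_intros simp: algebra_simps)
  then have "((\<lambda>s. p s / s) \<longlongrightarrow> ?d * J - P) (at 0)"
    by (simp add: has_field_derivative_iff p_def)
  then have lim1: "((\<lambda>s. \<bar>p s / s\<bar>) \<longlongrightarrow> \<bar>?d * J - P\<bar>) (at_right 0)"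
    by (intro tendsto_rabs) (auto intro: filterlim_at_split[THEN iffD1, THEN conjunct2])
  have lim2: "((\<lambda>s::real. G * (\<mu> * (1 - (1 - s) ^ ?d))) \<longlongrightarrow> G * (\<mu> * (1 - (1 - 0) ^ ?d))) (at_right 0)"
    by (intro tendsto_intros)
  have "eventually (\<lambda>s. \<bar>p s / s\<bar> \<le> G * (\<mu> * (1 - (1 - s) ^ ?d))) (at_right 0)"
    unfolding eventually_at_right_field
  proof (intro exI[of _ 1] conjI allI impI)
    fix s :: real assume "0 < s" "s < 1"
    then show "\<bar>p s / s\<bar> \<le> G * (\<mu> * (1 - (1 - s) ^ ?d))"
      using key[of s] by (simp add: abs_divide divide_le_eq mult_ac)
  qed simp
  from tendsto_le[OF _ lim2 lim1 this] have "?d * J = P"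
    by simp
  then show ?thesis
    unfolding P_def J_def I_def K_def by (simp add: algebra_simps)
qed

text \<open>For the constant \<open>g = 1\<close> the moment identity becomes an equation for the
  integral of the coordinate alone.\<close>

lemma integral_cone:
  fixes v a :: "'a::euclidean_space" and b :: real
  assumes T: "T = convex hull (insert v W)" and W: "finite W" "W \<noteq> {}"
    and lv: "a \<bullet> v + b = 1" and lW: "\<And>w. w \<in> W \<Longrightarrow> a \<bullet> w + b = 0"
  shows "(LINT x:T|lborel. a \<bullet> x + b) = measure lborel T / (DIM('a) + 1)"
proof -
  have "compact T"
    unfolding T using W by (intro finite_imp_compact_convex_hull) auto
  then show ?thesis
    using integral_cone_mult_affine[OF assms, of 0 1]
    by (simp add: set_integral_const_compact field_simps)
qed

text \<open>A copy of ratio \<open>c\<close> contributes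
  \<open>c ^ d * ((1 - c) * g v * \<mu> + c * K)\<close>, where \<open>d\<close> is the dimension,
  \<open>g\<close> the affine function, \<open>\<mu>\<close> the volume and \<open>K\<close> the
  integral of \<open>g\<close>. The weight \<open>2 ^ d\<close> gives both copies the common factor
  \<open>(1/2) ^ d\<close>, and the outer factor then makes the coefficient of \<open>K\<close>
  equal to \<open>- 1 / (d + 2)\<close>, opposite to the one in the integral of the coordinate times
  \<open>g\<close>.\<close>

lemma integral_cone_dual:
  fixes v a a' :: "'a::euclidean_space" and b b' :: real
  assumes T: "T = convex hull (insert v W)" and W: "finite W" "W \<noteq> {}"
    and lv: "a \<bullet> v + b = 1" and lW: "\<And>w. w \<in> W \<Longrightarrow> a \<bullet> w + b = 0"
  shows "(LINT x:T|lborel. (a \<bullet> x + b + 2 ^ (DIM('a) + 2) / real (DIM('a) + 2) *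
      (2 ^ DIM('a) * indicator (homothety v (1/4) ` T) x - indicator (homothety v (1/2) ` T) x))
        * (a' \<bullet> x + b'))
    = (a' \<bullet> v + b') * measure lborel T / (DIM('a) + 1)"
proof -
  let ?d = "DIM('a)"
  let ?k = "2 ^ (?d + 2) / real (?d + 2) :: real"
  let ?l = "\<lambda>x. a \<bullet> x + b" and ?g = "\<lambda>x. a' \<bullet> x + b'"
  let ?H = "\<lambda>c. homothety v c ` T"
  define K where "K = (LINT x:T|lborel. ?g x)"
  define \<mu> where "\<mu> = measure lborel T"
  have cT: "compact T"
    unfolding T using W by (intro finite_imp_compact_convex_hull) auto
  have vT: "v \<in> T" and convT: "convex T"
    unfolding T by (auto intro: hull_inc)
  have part: "set_integrable lborel T (\<lambda>x. indicator (?H c) x * ?g x)"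
    "(LINT x:T|lborel. indicator (?H c) x * ?g x) = c ^ ?d * ((1 - c) * ?g v * \<mu> + c * K)"
    if c: "0 < c" "c \<le> 1" for c
  proof -
    have "?H c \<subseteq> T"
      using c by (intro homothety_image_subset convT vT) auto
    then have *: "(\<lambda>x. indicator T x *\<^sub>R (indicator (?H c) x * ?g x)) = (\<lambda>x. indicator (?H c) x *\<^sub>R ?g x)"
      by (auto simp: indicator_def fun_eq_iff)
    have "set_integrable lborel (?H c) ?g"
      by (intro set_integrable_compact compact_homothety cT continuous_intros)
    then show "set_integrable lborel T (\<lambda>x. indicator (?H c) x * ?g x)"
      unfolding set_integrable_def * .
    have "(LINT x:T|lborel. indicator (?H c) x * ?g x) = (LINT x:?H c|lborel. ?g x)"
      unfolding set_lebesgue_integral_def * ..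
    also have "\<dots> = c ^ ?d * (LINT x:T|lborel. (1 - c) * ?g v + c * ?g x)"
      using c by (subst set_integral_homothety[OF _ cT]) (auto simp: affine_homothety)
    also have "(LINT x:T|lborel. (1 - c) * ?g v + c * ?g x) = (1 - c) * ?g v * \<mu> + c * K"
      unfolding K_def \<mu>_def
      by (subst set_integral_add(2))
        (auto intro!: set_integrable_compact cT continuous_intros simp: set_integral_const_compact cT)
    finally show "(LINT x:T|lborel. indicator (?H c) x * ?g x) = c ^ ?d * ((1 - c) * ?g v * \<mu> + c * K)" .
  qed
  have lg: "set_integrable lborel T (\<lambda>x. ?l x * ?g x)"
    by (intro set_integrable_compact cT continuous_intros)
  have J: "(LINT x:T|lborel. ?l x * ?g x) = (K + ?g v * (\<mu> / (?d + 1))) / (?d + 2)"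
    using integral_cone_mult_affine[OF assms, of a' b'] integral_cone[OF assms]
    unfolding K_def \<mu>_def by (simp add: eq_divide_eq mult.commute)
  have "(LINT x:T|lborel. (?l x + ?k * (2 ^ ?d * indicator (?H (1/4)) x - indicator (?H (1/2)) x)) * ?g x)
    = (LINT x:T|lborel. ?l x * ?g x + ?k * (2 ^ ?d * (indicator (?H (1/4)) x * ?g x)
        - indicator (?H (1/2)) x * ?g x))"
  proof -
    have "(l + k * (p * i - j)) * g = l * g + k * (p * (i * g) - j * g)" for l k p i j g :: real
      by algebra
    then show ?thesis
      by (simp only:)
  qed
  also have "\<dots> = (LINT x:T|lborel. ?l x * ?g x) +
      ?k * (2 ^ ?d * (LINT x:T|lborel. indicator (?H (1/4)) x * ?g x)
        - (LINT x:T|lborel. indicator (?H (1/2)) x * ?g x))"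
  proof -
    have i: "set_integrable lborel T (\<lambda>x. 2 ^ ?d * (indicator (?H (1/4)) x * ?g x))"
      "set_integrable lborel T (\<lambda>x. indicator (?H (1/2)) x * ?g x)"
      using part(1)[of "1/4"] part(1)[of "1/2"] by auto
    show ?thesis
      by (simp only: set_integral_add(2)[OF lg set_integrable_mult_right[OF set_integral_diff(1)[OF i]]]
          set_integral_mult_right set_integral_diff(2)[OF i])
  qed
  also have "\<dots> = (K + ?g v * (\<mu> / (?d + 1))) / (?d + 2) +
      ?k * (2 ^ ?d * ((1/4) ^ ?d * (3/4 * ?g v * \<mu> + 1/4 * K)) - (1/2) ^ ?d * (1/2 * ?g v * \<mu> + 1/2 * K))"
    by (simp add: J part(2))
  also have "\<dots> = (K + ?g v * (\<mu> / (?d + 1))) / (?d + 2) + (?g v * \<mu> - K) / (?d + 2)"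
  proof -
    \<comment> \<open>With equal powers in front, the brackets subtract to
      \<open>3/4 - 1/2 = 1/4\<close> for the vertex value and \<open>1/4 - 1/2 = - 1/4\<close> for
      \<open>K\<close>.\<close>
    have "2 ^ ?d * (1/4) ^ ?d = (1/2 :: real) ^ ?d"
      by (simp flip: power_mult_distrib)
    then have "2 ^ ?d * ((1/4) ^ ?d * (3/4 * ?g v * \<mu> + 1/4 * K)) - (1/2) ^ ?d * (1/2 * ?g v * \<mu> + 1/2 * K)
        = (1/2) ^ ?d * ((?g v * \<mu> - K) / 4)"
      by (simp add: mult.assoc[symmetric]) (simp add: algebra_simps)
    then have "?k * (2 ^ ?d * ((1/4) ^ ?d * (3/4 * ?g v * \<mu> + 1/4 * K)) - (1/2) ^ ?d * (1/2 * ?g v * \<mu> + 1/2 * K))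
        = ?k * (1/2) ^ ?d * ((?g v * \<mu> - K) / 4)"
      by (simp only: mult.assoc)
    also have "?k * (1/2) ^ ?d = 4 / (?d + 2)"
      by (simp add: power_add power_one_over)
    also have "4 / (?d + 2) * ((?g v * \<mu> - K) / 4) = (?g v * \<mu> - K) / (?d + 2)"
    proof -
      have "4 / n * (z / 4) = z / n" for n z :: real
        by simp
      then show ?thesis .
    qed
    finally show ?thesis
      by (simp only:)
  qed
  \<comment> \<open>\<open>K\<close> cancels, and
    \<open>1 / (d + 1) + 1 = (d + 2) / (d + 1)\<close>.\<close>
  also have "\<dots> = ?g v * \<mu> / (?d + 1)"
    by (simp add: divide_simps) (simp add: algebra_simps)
  finally show ?thesis
    unfolding \<mu>_def .
qed

text \<open>The frontier of a convex set is negligible, and \<open>lebesgue\<close> is the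
  completion of \<open>lborel\<close>. This links the integrals over open cells of the domain with
  the moments of closed simplices.\<close>

lemma integral_interior_eq_lborel:
  fixes g :: "'a::euclidean_space \<Rightarrow> real"
  assumes T: "compact T" "convex T" and g: "g \<in> borel_measurable borel"
  shows "(LINT x:interior T|lebesgue. g x) = (LINT x:T|lborel. g x)"
proof -
  have mT: "T \<in> sets borel"
    using T by (simp add: borel_compact)
  have "AE x in lebesgue. x \<notin> frontier T"
    using negligible_convex_frontier[OF T(2)] by (auto simp: negligible_iff_null_sets intro: AE_not_in)
  then have "AE x in lebesgue. indicator (interior T) x *\<^sub>R g x = indicator T x *\<^sub>R g x"
  proof (eventually_elim)
    case (elim x)
    then have "x \<in> interior T \<longleftrightarrow> x \<in> T"
      using T compact_imp_closed interior_subset by (auto simp: frontier_def closure_closed)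
    then show ?case
      by (simp add: indicator_def)
  qed
  then have "(LINT x:interior T|lebesgue. g x) = (LINT x:T|lebesgue. g x)"
    unfolding set_lebesgue_integral_def
    by (intro integral_cong_AE measurable_completion borel_measurable_scaleR borel_measurable_indicator)
      (use mT g in auto)
  also have "\<dots> = (LINT x:T|lborel. g x)"
    unfolding set_lebesgue_integral_def by (intro integral_completion borel_measurable_scaleR borel_measurable_indicator)
      (use mT g in auto)
  finally show ?thesis .
qed

section \<open>Square integrable functions\<close>

lemma set_integrable_mult_bounded:
  fixes f g :: "'a \<Rightarrow> real"
  assumes A: "A \<in> sets M" "emeasure M A < \<infinity>"
    and f: "set_borel_measurable M A f" "\<And>x. x \<in> A \<Longrightarrow> \<bar>f x\<bar> \<le> B"
    and g: "set_borel_measurable M A g" "\<And>x. x \<in> A \<Longrightarrow> \<bar>g x\<bar> \<le> C"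
  shows "set_integrable M A (\<lambda>x. f x * g x)"
proof (rule set_integrable_bound)
  show "set_integrable M A (\<lambda>x. B * C)"
    using A by (simp add: set_integrable_def)
  \<comment> \<open>Measurability is known only for the truncated factors; their product is the
    truncated product because an indicator is idempotent.\<close>
  have "(\<lambda>x. (indicator A x *\<^sub>R f x) * (indicator A x *\<^sub>R g x)) \<in> borel_measurable M"
    using f(1) g(1) unfolding set_borel_measurable_def by measurable
  also have "(\<lambda>x. (indicator A x *\<^sub>R f x) * (indicator A x *\<^sub>R g x)) = (\<lambda>x. indicator A x *\<^sub>R (f x * g x))"
    by (auto simp: fun_eq_iff indicator_def)
  finally show "set_borel_measurable M A (\<lambda>x. f x * g x)"
    unfolding set_borel_measurable_def .
  show "AE x in M. x \<in> A \<longrightarrow> norm (f x * g x) \<le> norm (B * C)"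
  proof (intro AE_I2 impI)
    fix x assume x: "x \<in> A"
    have "\<bar>f x\<bar> * \<bar>g x\<bar> \<le> B * C"
      using f(2)[OF x] g(2)[OF x] by (intro mult_mono) auto
    then show "norm (f x * g x) \<le> norm (B * C)"
      using abs_ge_self[of "B * C"] by (simp add: abs_mult)
  qed
qed

text \<open>Discriminant argument: \<open>f - t * g\<close> has a nonnegative square integral for
  every \<open>t\<close>. Integrability of the three products justifies expanding it into a
  quadratic in \<open>t\<close>.\<close>

lemma L2_inner_Cauchy_Schwarz:
  assumes f: "set_integrable lebesgue \<Omega> (\<lambda>x. f x * f x)"
    and g: "set_integrable lebesgue \<Omega> (\<lambda>x. g x * g x)"
    and fg: "set_integrable lebesgue \<Omega> (\<lambda>x. f x * g x)"
  shows "\<bar>L2_inner \<Omega> f g\<bar> \<le> L2_norm \<Omega> f * L2_norm \<Omega> g"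
proof -
  define A where "A = L2_inner \<Omega> f f"
  define B where "B = L2_inner \<Omega> f g"
  define D where "D = L2_inner \<Omega> g g"
  have nonneg: "0 \<le> L2_inner \<Omega> u u" for u
    unfolding L2_inner_def set_lebesgue_integral_def by (intro integral_nonneg_AE) auto
  have quad: "0 \<le> A - 2 * t * B + t\<^sup>2 * D" for t
  proof -
    have 1: "set_integrable lebesgue \<Omega> (\<lambda>x. (2 * t) * (f x * g x))"
      by (intro set_integrable_mult_right fg)
    have 2: "set_integrable lebesgue \<Omega> (\<lambda>x. t\<^sup>2 * (g x * g x))"
      by (intro set_integrable_mult_right g)
    have "L2_inner \<Omega> (\<lambda>x. f x - t * g x) (\<lambda>x. f x - t * g x)
      = (LINT x:\<Omega>|lebesgue. f x * f x - (2 * t) * (f x * g x) + t\<^sup>2 * (g x * g x))"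
      unfolding L2_inner_def by (simp add: algebra_simps power2_eq_square)
    also have "\<dots> = A - 2 * t * B + t\<^sup>2 * D"
      unfolding A_def B_def D_def L2_inner_def
      by (simp only: set_integral_add(2)[OF set_integral_diff(1)[OF f 1] 2] set_integral_diff(2)[OF f 1]
          set_integral_mult_right)
    finally show ?thesis
      using nonneg by metis
  qed
  have "B\<^sup>2 \<le> A * D"
  proof (cases "D = 0")
    case True
    have "B = 0"
    proof (rule ccontr)
      assume "B \<noteq> 0"
      then show False
        \<comment> \<open>For \<open>D = 0\<close> the quadratic is linear in \<open>t\<close>, and
          this \<open>t\<close> gives it the value \<open>- 1\<close>.\<close>
        using quad[of "(A + 1) / (2 * B)"] True by simp
    qed
    with True show ?thesis
      by simp
  next
    case False
    then have "D > 0"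
      using nonneg[of g] by (simp add: D_def)
    \<comment> \<open>\<open>B / D\<close> is the minimiser of the quadratic.\<close>
    moreover have "0 \<le> A - B\<^sup>2 / D"
      using quad[of "B / D"] False by (simp add: power2_eq_square)
    ultimately show ?thesis
      by (simp add: field_simps)
  qed
  then have "\<bar>B\<bar> \<le> sqrt (A * D)"
    by (metis real_sqrt_abs real_sqrt_le_mono)
  then show ?thesis
    by (simp add: L2_norm_def A_def B_def D_def real_sqrt_mult)
qed

lemma L2_norm_le_of_bounded:
  assumes \<Omega>: "\<Omega> \<in> sets lebesgue" "emeasure lebesgue \<Omega> < \<infinity>" and P: "P \<in> lmeasurable"
    and f: "set_borel_measurable lebesgue \<Omega> f" "\<And>x. x \<in> \<Omega> \<Longrightarrow> \<bar>f x\<bar> \<le> M"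
    and off: "\<And>x. x \<in> \<Omega> \<Longrightarrow> x \<notin> P \<Longrightarrow> f x = 0" and M: "M \<ge> 0"
  shows "L2_norm \<Omega> f \<le> M * sqrt (measure lebesgue P)"
proof -
  have "L2_inner \<Omega> f f \<le> (LINT x|lebesgue. M\<^sup>2 * indicator P x)"
    unfolding L2_inner_def set_lebesgue_integral_def
  proof (rule integral_mono)
    show "integrable lebesgue (\<lambda>x. indicator \<Omega> x *\<^sub>R (f x * f x))"
      using set_integrable_mult_bounded[OF \<Omega> f f] by (simp add: set_integrable_def)
    show "integrable lebesgue (\<lambda>x. M\<^sup>2 * indicator P x)"
      using P by (auto simp: fmeasurable_def)
    fix x
    show "indicator \<Omega> x *\<^sub>R (f x * f x) \<le> M\<^sup>2 * indicator P x"
    proof (cases "x \<in> \<Omega> \<and> x \<in> P")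
      case True
      then have "(f x)\<^sup>2 \<le> M\<^sup>2"
        using f(2)[of x] M by (simp add: abs_le_square_iff[symmetric])
      with True show ?thesis
        by (simp add: power2_eq_square)
    qed (use off in \<open>auto simp: indicator_def\<close>)
  qed
  also have "\<dots> = M\<^sup>2 * measure lebesgue P"
    by simp
  finally have "L2_norm \<Omega> f \<le> sqrt (M\<^sup>2 * measure lebesgue P)"
    unfolding L2_norm_def by (rule real_sqrt_le_mono)
  then show ?thesis
    using M by (simp add: real_sqrt_mult)
qed

section \<open>Partitions and red-refinement\<close>

text \<open>The extreme points of a simplex are its affinely independent generators. Splitting one
  off presents the simplex as a cone over the opposite facet, the form used for the moments;
  positive dimension keeps the base nonempty.\<close>

lemma simplex_eq_hull_insert:
  assumes T: "n simplex T" "0 < n" and v: "v extreme_point_of T"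
  obtains W where "finite W" "W \<noteq> {}" "T = convex hull (insert v W)" "v \<notin> W"
    "\<And>w. w \<in> W \<Longrightarrow> w extreme_point_of T"
proof -
  obtain C where C: "finite C" "\<not> affine_dependent C" "int (card C) = n + 1" "T = convex hull C"
    using T by (auto simp: simplex)
  have ext: "x extreme_point_of T \<longleftrightarrow> x \<in> C" for x
    using extreme_point_of_convex_hull_affine_independent[OF C(2)] C(4) by simp
  have v: "v \<in> C"
    using v ext by simp
  have "C \<noteq> {v}"
    using C(3) T(2) by auto
  show thesis
  proof (rule that[of "C - {v}"])
    show "T = convex hull insert v (C - {v})"
      using C(4) v by (simp add: insert_absorb)
  qed (use C(1) v \<open>C \<noteq> {v}\<close> ext in auto)
qed

text \<open>A proper face misses the interior. Applied in \<open>T\<close> this forces the common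
  face to be all of \<open>T\<close>; then \<open>T\<close> is a face of \<open>T'\<close> that
  meets the interior of \<open>T'\<close>.\<close>

lemma triangulation_interior_unique:
  assumes "triangulation \<T>" "T \<in> \<T>" "T' \<in> \<T>" "x \<in> interior T" "x \<in> T'"
  shows "T' = T"
proof -
  have face: "(T \<inter> T') face_of T" "(T \<inter> T') face_of T'"
    using assms(1-3) unfolding triangulation_def by (metis, metis Int_commute)
  have x: "x \<in> T"
    using assms(4) interior_subset by blast
  have "T \<inter> T' = T"
    using face_of_disjoint_interior[OF face(1)] assms(4,5) x by blast
  then have "T face_of T'" "x \<in> interior T'"
    using face(2) interior_mono[of T T'] assms(4) by auto
  then show ?thesis
    using face_of_disjoint_interior x by blast
qed

text \<open>An extreme point is a one-point face; it is inherited by the common face, and faces of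
  faces are faces.\<close>

lemma triangulation_extreme_point:
  assumes "triangulation \<T>" "T \<in> \<T>" "T' \<in> \<T>" "v extreme_point_of T" "v \<in> T'"
  shows "v extreme_point_of T'"
proof -
  have face: "(T \<inter> T') face_of T" "(T \<inter> T') face_of T'"
    using assms(1-3) unfolding triangulation_def by (metis, metis Int_commute)
  have "{v} face_of T"
    using assms(4) by (simp add: face_of_singleton)
  then have "{v} face_of (T \<inter> T')"
    using assms(4,5) by (intro face_of_subset[OF \<open>{v} face_of T\<close>]) (auto simp: extreme_point_of_def)
  then show ?thesis
    using face(2) face_of_trans face_of_singleton by blast
qed

lemma red_refinement_members_at_vertex:
  assumes ref: "red_refinement \<T> \<S>"
    and ext: "\<And>T. T \<in> \<T> \<Longrightarrow> v \<in> T \<Longrightarrow> v extreme_point_of T"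
  shows "{K \<in> \<S>. v \<in> K} = (\<lambda>T. homothety v (1/2) ` T) ` {T \<in> \<T>. v \<in> T}"
    and "\<And>K. K \<in> \<S> \<Longrightarrow> v \<in> K \<Longrightarrow> v extreme_point_of K"
proof -
  obtain R where R: "\<And>T. T \<in> \<T> \<Longrightarrow> red_subdivision T (R T)" and \<S>: "\<S> = (\<Union>T\<in>\<T>. R T)"
    using ref by (auto simp: red_refinement_def)
  have sub: "K \<subseteq> T" if "T \<in> \<T>" "K \<in> R T" for K T
    using R[OF that(1)] that(2) by (auto simp: red_subdivision_def)
  have at: "{K \<in> R T. v \<in> K} = {homothety v (1/2) ` T}" if "T \<in> \<T>" "v \<in> T" for T
    using R[OF that(1)] ext[OF that] by (simp add: red_subdivision_def)
  show "{K \<in> \<S>. v \<in> K} = (\<lambda>T. homothety v (1/2) ` T) ` {T \<in> \<T>. v \<in> T}" (is "?L = ?R")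
  proof
    show "?L \<subseteq> ?R"
    proof
      fix K assume "K \<in> ?L"
      then obtain T where T: "T \<in> \<T>" "K \<in> R T" "v \<in> K"
        unfolding \<S> by blast
      then have "v \<in> T"
        using sub by blast
      with T at[of T] show "K \<in> ?R"
        by blast
    qed
    show "?R \<subseteq> ?L"
      using at unfolding \<S> by blast
  qed
  fix K assume "K \<in> \<S>" "v \<in> K"
  then obtain T where T: "T \<in> \<T>" "K \<in> R T"
    unfolding \<S> by blast
  then have "K \<subseteq> T"
    by (rule sub)
  with \<open>v \<in> K\<close> ext[OF T(1)] show "v extreme_point_of K"
    unfolding extreme_point_of_def by blast
qed

text \<open>A finite union of polytopes is closed, so it contains \<open>closure \<Omega>\<close>,
  and taking interiors leads back to \<open>\<Omega>\<close>. The last equation places the interiors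
  of the simplices inside \<open>\<Omega>\<close>.\<close>

lemma polytopal_domain_imp:
  assumes "polytopal_domain \<Omega>"
  shows "open \<Omega>" "bounded \<Omega>" "interior (closure \<Omega>) = \<Omega>"
proof -
  obtain P where P: "finite P" "\<And>p. p \<in> P \<Longrightarrow> polytope p" and \<Omega>: "\<Omega> = interior (\<Union>P)"
    using assms by (auto simp: polytopal_domain_def)
  show "open \<Omega>"
    by (simp add: \<Omega>)
  have "compact (\<Union>P)"
    using P by (intro compact_Union) (auto intro: polytope_imp_compact)
  then show "bounded \<Omega>"
    using bounded_subset[OF compact_imp_bounded interior_subset] by (simp add: \<Omega>)
  have "closure \<Omega> \<subseteq> \<Union>P"
    unfolding \<Omega> using \<open>compact (\<Union>P)\<close> by (intro closure_minimal interior_subset compact_imp_closed)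
  then have "interior (closure \<Omega>) \<subseteq> \<Omega>"
    unfolding \<Omega> by (rule interior_mono)
  moreover have "\<Omega> \<subseteq> interior (closure \<Omega>)"
    using \<open>open \<Omega>\<close> by (intro interior_maximal closure_subset)
  ultimately show "interior (closure \<Omega>) = \<Omega>"
    by blast
qed

section \<open>The nodal basis and its dual system\<close>

text \<open>One partition with its two refinements. The constants obtained here depend on
  \<open>DIM('a)\<close> only, which makes them uniform over a family.\<close>

locale refined_nodal_basis =
  fixes \<Omega> \<gamma> :: "'a::euclidean_space set" and \<T> \<T>\<^sub>1 \<T>\<^sub>2 :: "'a set set"
    and \<phi> :: "'a \<Rightarrow> 'a \<Rightarrow> real"
  assumes domain: "polytopal_domain \<Omega>"
    and partition: "conforming_partition \<Omega> \<T>"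
    and nodal: "nodal_basis \<Omega> \<gamma> \<T> \<phi>"
    and refine1: "red_refinement \<T> \<T>\<^sub>1"
    and refine2: "red_refinement \<T>\<^sub>1 \<T>\<^sub>2"
begin

abbreviation "\<psi> \<equiv> psi \<phi> \<T>\<^sub>1 \<T>\<^sub>2"
abbreviation "N \<equiv> free_vertices \<gamma> \<T>"

text \<open>On \<open>T\<close> the nodal function is the barycentric coordinate of
  \<open>\<nu>\<close>, and \<open>W\<close> holds the remaining vertices. The conjuncts are the
  hypotheses of the cone lemmas.\<close>

definition nodal_piece :: "'a set \<Rightarrow> 'a \<Rightarrow> 'a set \<Rightarrow> 'a \<Rightarrow> real \<Rightarrow> bool" where
  "nodal_piece T \<nu> W a b \<longleftrightarrow> T = convex hull (insert \<nu> W) \<and> finite W \<and> W \<noteq> {} \<and>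
     a \<bullet> \<nu> + b = 1 \<and> (\<forall>w\<in>W. a \<bullet> w + b = 0) \<and> (\<forall>x\<in>T. \<phi> \<nu> x = a \<bullet> x + b)"

section \<open>Geometry of the members of the partition\<close>

lemma triangulation: "triangulation \<T>"
  and simplex: "T \<in> \<T> \<Longrightarrow> int DIM('a) simplex T"
  and Union_partition: "\<Union>\<T> = closure \<Omega>"
  and finite_partition: "finite \<T>"
  using partition by (auto simp: conforming_partition_def triangulation_def)

lemma compact_member: "T \<in> \<T> \<Longrightarrow> compact T"
  and convex_member: "T \<in> \<T> \<Longrightarrow> convex T"
  using simplex compact_simplex convex_simplex by blast+

lemma interior_member_ne:
  assumes "T \<in> \<T>"
  shows "interior T \<noteq> {}"
proof -
  have dim: "aff_dim T = int DIM('a)"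
    using aff_dim_simplex[OF simplex[OF assms]] .
  then have "rel_interior T = interior T"
    by (intro rel_interior_interior) (simp add: aff_dim_eq_full)
  moreover have "T \<noteq> {}"
    using dim by force
  ultimately show ?thesis
    using rel_interior_eq_empty[OF convex_member[OF assms]] by simp
qed

lemma closure_interior_member: "T \<in> \<T> \<Longrightarrow> closure (interior T) = T"
  by (simp add: convex_closure_interior convex_member interior_member_ne compact_member compact_imp_closed)

lemma interior_member_subset: "T \<in> \<T> \<Longrightarrow> interior T \<subseteq> \<Omega>"
  using interior_mono[of T "closure \<Omega>"] polytopal_domain_imp(3)[OF domain] Union_partition by auto

lemma interior_unique: "T \<in> \<T> \<Longrightarrow> T' \<in> \<T> \<Longrightarrow> x \<in> interior T \<Longrightarrow> x \<in> T' \<Longrightarrow> T' = T"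
  using triangulation_interior_unique[OF triangulation] .

lemma obtain_member:
  assumes "x \<in> closure \<Omega>"
  obtains T where "T \<in> \<T>" "x \<in> T"
  using assms Union_partition by auto

lemma free_vertex_extreme:
  assumes "\<nu> \<in> N" "T \<in> \<T>" "\<nu> \<in> T"
  shows "\<nu> extreme_point_of T"
proof -
  obtain S where "S \<in> \<T>" "\<nu> extreme_point_of S"
    using assms(1) by (auto simp: free_vertices_def)
  then show ?thesis
    using triangulation_extreme_point[OF triangulation _ assms(2) _ assms(3)] by blast
qed

section \<open>The nodal functions on a single simplex\<close>

lemma phi_affine:
  assumes "\<nu> \<in> N" "T \<in> \<T>"
  obtains a b where "\<And>x. x \<in> T \<Longrightarrow> \<phi> \<nu> x = a \<bullet> x + b"
proof -
  have "\<phi> \<nu> \<in> fe_space \<Omega> \<gamma> \<T>"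
    using nodal assms(1) by (simp add: nodal_basis_def)
  then have "\<exists>a b. \<forall>x\<in>T. \<phi> \<nu> x = a \<bullet> x + b"
    using assms(2) by (simp add: fe_space_def)
  then show ?thesis
    by (elim exE) (rule that, simp)
qed

text \<open>\<open>nodal_basis\<close> prescribes values at free vertices only; at a vertex on
  \<open>\<gamma>\<close> the value 0 comes from the boundary condition.\<close>

lemma phi_vertex:
  assumes "\<nu> \<in> N" "T \<in> \<T>" "w extreme_point_of T"
  shows "\<phi> \<nu> w = of_bool (\<nu> = w)"
proof (cases "w \<in> \<gamma>")
  case True
  then have "\<phi> \<nu> w = 0"
    using nodal assms(1) by (auto simp: nodal_basis_def fe_space_def)
  moreover have "\<nu> \<noteq> w"
    using True assms(1) by (auto simp: free_vertices_def)
  ultimately show ?thesis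
    by simp
next
  case False
  then have "w \<in> N"
    using assms by (auto simp: free_vertices_def)
  then show ?thesis
    using nodal assms(1) by (simp add: nodal_basis_def)
qed

lemma nodal_piece_exists:
  assumes "\<nu> \<in> N" "T \<in> \<T>" "\<nu> \<in> T"
  obtains W a b where "nodal_piece T \<nu> W a b"
proof -
  obtain a b where ab: "\<And>x. x \<in> T \<Longrightarrow> \<phi> \<nu> x = a \<bullet> x + b"
    using phi_affine assms by metis
  obtain W where W: "finite W" "W \<noteq> {}" "T = convex hull (insert \<nu> W)" "\<nu> \<notin> W"
    "\<And>w. w \<in> W \<Longrightarrow> w extreme_point_of T"
    using simplex_eq_hull_insert[OF simplex[OF assms(2)] _ free_vertex_extreme[OF assms]] by auto
  have "a \<bullet> \<nu> + b = 1"
    using phi_vertex[OF assms(1,2) free_vertex_extreme[OF assms]] ab[OF assms(3)] by simp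
  moreover have "a \<bullet> w + b = 0" if "w \<in> W" for w
  proof -
    have "w \<in> T"
      using W(5)[OF that] by (simp add: extreme_point_of_def)
    moreover have "\<nu> \<noteq> w"
      using W(4) that by blast
    ultimately show ?thesis
      using phi_vertex[OF assms(1,2) W(5)[OF that]] ab by simp
  qed
  ultimately show ?thesis
    using W(1-3) ab by (intro that[of W a b]) (simp add: nodal_piece_def)
qed

text \<open>All vertices of \<open>T\<close> lie in the zero set of one affine function, which is
  convex, and \<open>T\<close> is the hull of its vertices.\<close>

lemma phi_eq_0:
  assumes "\<nu> \<in> N" "T \<in> \<T>" "\<nu> \<notin> T" "x \<in> T"
  shows "\<phi> \<nu> x = 0"
proof -
  obtain a b where ab: "\<And>x. x \<in> T \<Longrightarrow> \<phi> \<nu> x = a \<bullet> x + b"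
    using phi_affine assms by metis
  have T: "T = convex hull {w. w extreme_point_of T}"
    by (intro Krein_Milman_Minkowski compact_member convex_member assms(2))
  have "{w. w extreme_point_of T} \<subseteq> {z. a \<bullet> z = - b}"
  proof clarify
    fix w assume w: "w extreme_point_of T"
    then have "w \<in> T"
      by (simp add: extreme_point_of_def)
    then have "\<nu> \<noteq> w"
      using assms(3) by blast
    then show "a \<bullet> w = - b"
      using phi_vertex[OF assms(1,2) w] ab[OF \<open>w \<in> T\<close>] by simp
  qed
  then have "convex hull {w. w extreme_point_of T} \<subseteq> {z. a \<bullet> z = - b}"
    by (intro hull_minimal convex_hyperplane)
  then have "a \<bullet> x = - b"
    using T assms(4) by blast
  then show ?thesis
    using ab[OF assms(4)] by simp
qed

lemma abs_phi_le:
  assumes "\<nu> \<in> N" "x \<in> closure \<Omega>"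
  shows "\<bar>\<phi> \<nu> x\<bar> \<le> 1"
proof -
  obtain T where T: "T \<in> \<T>" "x \<in> T"
    using obtain_member assms(2) .
  show ?thesis
  proof (cases "\<nu> \<in> T")
    case True
    then obtain W a b where "nodal_piece T \<nu> W a b"
      using nodal_piece_exists[OF assms(1) T(1)] by blast
    then show ?thesis
      using affine_between_on_hull[of T \<nu> W a b x] T(2) by (auto simp: nodal_piece_def)
  qed (use phi_eq_0[OF assms(1) T(1) _ T(2)] in simp)
qed

text \<open>At a vertex only the prescribed corner subsimplices occur, and two halvings with the
  same centre compose to ratio \<open>1/4\<close>.\<close>

lemma refined_patches:
  assumes "\<nu> \<in> N"
  shows "patch \<T>\<^sub>1 \<nu> = (\<Union>T\<in>{T \<in> \<T>. \<nu> \<in> T}. homothety \<nu> (1/2) ` T)"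
    and "patch \<T>\<^sub>2 \<nu> = (\<Union>T\<in>{T \<in> \<T>. \<nu> \<in> T}. homothety \<nu> (1/4) ` T)"
proof -
  have at1: "{K \<in> \<T>\<^sub>1. \<nu> \<in> K} = (\<lambda>T. homothety \<nu> (1/2) ` T) ` {T \<in> \<T>. \<nu> \<in> T}"
    and ext1: "\<And>K. K \<in> \<T>\<^sub>1 \<Longrightarrow> \<nu> \<in> K \<Longrightarrow> \<nu> extreme_point_of K"
    by (rule red_refinement_members_at_vertex[OF refine1]; use free_vertex_extreme[OF assms] in simp)+
  have at2: "{K \<in> \<T>\<^sub>2. \<nu> \<in> K} = (\<lambda>T. homothety \<nu> (1/2) ` T) ` {T \<in> \<T>\<^sub>1. \<nu> \<in> T}"
    by (rule red_refinement_members_at_vertex(1)[OF refine2 ext1])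
  show "patch \<T>\<^sub>1 \<nu> = (\<Union>T\<in>{T \<in> \<T>. \<nu> \<in> T}. homothety \<nu> (1/2) ` T)"
    unfolding patch_def at1 ..
  have "homothety \<nu> (1/2) ` homothety \<nu> (1/2) ` T = homothety \<nu> (1/4) ` T" for T
    unfolding image_image homothety_homothety by simp
  then show "patch \<T>\<^sub>2 \<nu> = (\<Union>T\<in>{T \<in> \<T>. \<nu> \<in> T}. homothety \<nu> (1/4) ` T)"
    unfolding patch_def at2 at1 image_image by simp
qed

lemma homothety_member_subset:
  assumes "T \<in> \<T>" "\<nu> \<in> T"
  shows "homothety \<nu> (1/2) ` T \<subseteq> T" "homothety \<nu> (1/4) ` T \<subseteq> T"
  by (rule homothety_image_subset[OF convex_member[OF assms(1)] assms(2)]; simp)+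

lemma refined_patches_subset:
  assumes "\<nu> \<in> N"
  shows "patch \<T>\<^sub>1 \<nu> \<subseteq> patch \<T> \<nu>" "patch \<T>\<^sub>2 \<nu> \<subseteq> patch \<T> \<nu>"
proof -
  show "patch \<T>\<^sub>1 \<nu> \<subseteq> patch \<T> \<nu>"
    unfolding refined_patches(1)[OF assms] unfolding patch_def
    using homothety_member_subset(1)[where \<nu> = \<nu>] by blast
  show "patch \<T>\<^sub>2 \<nu> \<subseteq> patch \<T> \<nu>"
    unfolding refined_patches(2)[OF assms] unfolding patch_def
    using homothety_member_subset(2)[where \<nu> = \<nu>] by blast
qed

lemma phi_off_patch:
  assumes "\<nu> \<in> N" "x \<in> closure \<Omega>" "x \<notin> patch \<T> \<nu>"
  shows "\<phi> \<nu> x = 0"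
proof -
  obtain T where T: "T \<in> \<T>" "x \<in> T"
    using obtain_member assms(2) .
  then show ?thesis
    using phi_eq_0[OF assms(1) T(1) _ T(2)] assms(3) by (auto simp: patch_def)
qed

lemma psi_off_patch:
  assumes "\<nu> \<in> N" "x \<in> closure \<Omega>" "x \<notin> patch \<T> \<nu>"
  shows "\<psi> \<nu> x = 0"
  using phi_off_patch[OF assms] refined_patches_subset[OF assms(1), THEN contra_subsetD, OF assms(3)]
  by (simp add: psi_def theta_def)

text \<open>An interior point of \<open>T\<close> lies in no other member, hence in no copy of
  another member, so the indicators of the patches reduce to those of the copies of
  \<open>T\<close>.\<close>

lemma psi_interior_eq:
  assumes "\<nu> \<in> N" "T \<in> \<T>" "\<nu> \<in> T" "x \<in> interior T"
  shows "\<psi> \<nu> x = \<phi> \<nu> x + 2 ^ (DIM('a) + 2) / real (DIM('a) + 2) *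
    (2 ^ DIM('a) * indicator (homothety \<nu> (1/4) ` T) x - indicator (homothety \<nu> (1/2) ` T) x)"
proof -
  have only: "x \<in> (\<Union>T\<in>{T \<in> \<T>. \<nu> \<in> T}. homothety \<nu> c ` T) \<longleftrightarrow> x \<in> homothety \<nu> c ` T"
    if "\<And>T. T \<in> \<T> \<Longrightarrow> \<nu> \<in> T \<Longrightarrow> homothety \<nu> c ` T \<subseteq> T" for c
  proof
    assume "x \<in> (\<Union>T\<in>{T \<in> \<T>. \<nu> \<in> T}. homothety \<nu> c ` T)"
    then obtain T' where "T' \<in> {T \<in> \<T>. \<nu> \<in> T}" and x: "x \<in> homothety \<nu> c ` T'"
      by (rule UN_E)
    then have T': "T' \<in> \<T>" "\<nu> \<in> T'"
      by auto
    have "x \<in> T'"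
      by (rule subsetD[OF that[OF T'] x])
    then show "x \<in> homothety \<nu> c ` T"
      using interior_unique[OF assms(2) T'(1) assms(4) \<open>x \<in> T'\<close>] x by simp
  next
    assume "x \<in> homothety \<nu> c ` T"
    then show "x \<in> (\<Union>T\<in>{T \<in> \<T>. \<nu> \<in> T}. homothety \<nu> c ` T)"
      using assms(2,3) by (intro UN_I) auto
  qed
  note halves = only[of "1/2", OF homothety_member_subset(1)] and quarters = only[of "1/4", OF homothety_member_subset(2)]
  show ?thesis
    unfolding psi_def theta_def indicator_def refined_patches[OF assms(1)] by (simp only: halves quarters)
qed

lemma abs_psi_le:
  assumes "\<nu> \<in> N" "x \<in> closure \<Omega>"
  shows "\<bar>\<psi> \<nu> x\<bar> \<le> 1 + 2 ^ (DIM('a) + 2) / real (DIM('a) + 2) * (2 ^ DIM('a) + 1)"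
proof -
  have "\<bar>2 ^ DIM('a) * indicator (patch \<T>\<^sub>2 \<nu>) x - indicator (patch \<T>\<^sub>1 \<nu>) x\<bar> \<le> (2 ^ DIM('a) + 1 :: real)"
    by (auto simp: indicator_def)
  then have "\<bar>theta \<T>\<^sub>1 \<T>\<^sub>2 \<nu> x\<bar> \<le> 2 ^ (DIM('a) + 2) / real (DIM('a) + 2) * (2 ^ DIM('a) + 1)"
    unfolding theta_def by (subst abs_mult) (simp add: mult_left_mono divide_right_mono)
  with abs_phi_le[OF assms] show ?thesis
    unfolding psi_def by linarith
qed

section \<open>Measurability and integration over the partition\<close>

lemma compact_patch: "compact (patch \<T> \<nu>)"
  unfolding patch_def using finite_partition compact_member by (intro compact_Union) auto

lemma patch_borel:
  assumes "\<nu> \<in> N"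
  shows "patch \<T>\<^sub>1 \<nu> \<in> sets borel" "patch \<T>\<^sub>2 \<nu> \<in> sets borel"
proof -
  have "compact (\<Union>T\<in>{T \<in> \<T>. \<nu> \<in> T}. homothety \<nu> c ` T)" for c
  proof (rule compact_UN)
    show "compact (homothety \<nu> c ` T)" if "T \<in> {T \<in> \<T>. \<nu> \<in> T}" for T
      using that by (intro compact_homothety compact_member) simp
  qed (simp add: finite_partition)
  then show "patch \<T>\<^sub>1 \<nu> \<in> sets borel" "patch \<T>\<^sub>2 \<nu> \<in> sets borel"
    unfolding refined_patches[OF assms] by (auto intro: borel_compact)
qed

lemma domain_measurable: "\<Omega> \<in> sets lebesgue" "emeasure lebesgue \<Omega> < \<infinity>"
proof -
  have o: "open \<Omega>" "bounded \<Omega>"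
    using polytopal_domain_imp[OF domain] by auto
  then show "\<Omega> \<in> sets lebesgue"
    by auto
  show "emeasure lebesgue \<Omega> < \<infinity>"
    using o emeasure_bounded_finite[of \<Omega>] by simp
qed

lemma phi_measurable: "\<nu> \<in> N \<Longrightarrow> set_borel_measurable lebesgue \<Omega> (\<phi> \<nu>)"
  using nodal by (auto simp: nodal_basis_def fe_space_def H1_def square_integrable_on_def)

lemma psi_measurable:
  assumes "\<nu> \<in> N"
  shows "set_borel_measurable lebesgue \<Omega> (\<psi> \<nu>)"
proof -
  have t: "theta \<T>\<^sub>1 \<T>\<^sub>2 \<nu> \<in> borel_measurable lebesgue"
    unfolding theta_def using patch_borel[OF assms]
    by (intro measurable_completion) (simp add: borel_measurable_indicator)
  have "(\<lambda>x. indicator \<Omega> x *\<^sub>R \<phi> \<nu> x + indicator \<Omega> x *\<^sub>R theta \<T>\<^sub>1 \<T>\<^sub>2 \<nu> x) \<in> borel_measurable lebesgue"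
    using phi_measurable[OF assms] unfolding set_borel_measurable_def
    by (rule borel_measurable_add)
      (intro borel_measurable_scaleR borel_measurable_indicator domain_measurable(1) t)
  then show ?thesis
    unfolding set_borel_measurable_def psi_def by (simp add: distrib_left)
qed

text \<open>The open simplices are disjoint and fill \<open>\<Omega>\<close> up to finitely many
  frontiers, which are negligible by convexity.\<close>

lemma set_integral_domain:
  fixes f :: "'a \<Rightarrow> real"
  assumes f: "set_integrable lebesgue \<Omega> f"
  shows "(LINT x:\<Omega>|lebesgue. f x) = (\<Sum>T\<in>\<T>. LINT x:interior T|lebesgue. f x)"
proof -
  let ?U = "\<Union>T\<in>\<T>. interior T"
  have sub: "?U \<subseteq> \<Omega>"
    using interior_member_subset by blast
  have "\<Omega> - ?U \<subseteq> (\<Union>T\<in>\<T>. frontier T)"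
  proof
    fix x assume x: "x \<in> \<Omega> - ?U"
    then have "x \<in> closure \<Omega>"
      using closure_subset by blast
    then obtain T where "T \<in> \<T>" "x \<in> T"
      by (rule obtain_member)
    moreover from this x have "x \<in> frontier T"
      using closure_subset[of T] by (auto simp: frontier_def)
    ultimately show "x \<in> (\<Union>T\<in>\<T>. frontier T)"
      by blast
  qed
  moreover have "negligible (\<Union>T\<in>\<T>. frontier T)"
    using finite_partition by (intro negligible_Union) (auto intro: negligible_convex_frontier convex_member)
  ultimately have "negligible (\<Omega> - ?U)"
    using negligible_subset by blast
  then have "AE x in lebesgue. x \<notin> \<Omega> - ?U"
    by (intro AE_not_in) (simp only: negligible_iff_null_sets)
  then have "AE x in lebesgue. x \<in> \<Omega> \<longleftrightarrow> x \<in> ?U"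
    by eventually_elim (use sub in blast)
  moreover have U: "?U \<in> sets lebesgue"
    by (intro sets_completionI_sets) (simp add: borel_open open_UN)
  moreover have "set_integrable lebesgue ?U f"
    by (rule set_integrable_subset[OF f U sub])
  ultimately have "(LINT x:\<Omega>|lebesgue. f x) = (LINT x:?U|lebesgue. f x)"
    using f by (intro set_integral_cong_set)
      (auto simp: set_integrable_def set_borel_measurable_def)
  also have "\<dots> = (\<Sum>T\<in>\<T>. LINT x:interior T|lebesgue. f x)"
  proof (rule set_integral_finite_Union)
    show "disjoint_family_on interior \<T>"
      unfolding disjoint_family_on_def
    proof (intro ballI impI)
      fix S T assume "S \<in> \<T>" "T \<in> \<T>" "S \<noteq> T"
      then show "interior S \<inter> interior T = {}"
        using interior_unique[of S T] interior_subset[of T] by auto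
    qed
    show "set_integrable lebesgue (interior T) f" if "T \<in> \<T>" for T
      using interior_member_subset[OF that] by (intro set_integrable_subset[OF f]) simp_all
  qed (simp_all add: finite_partition)
  finally show ?thesis .
qed

lemma measure_patch:
  "measure lebesgue (patch \<T> \<nu>) = (\<Sum>T\<in>{T \<in> \<T>. \<nu> \<in> T}. measure lborel T)"
proof -
  have "measure lebesgue (\<Union>{T \<in> \<T>. \<nu> \<in> T}) = (\<Sum>T\<in>{T \<in> \<T>. \<nu> \<in> T}. measure lebesgue T)"
  proof (rule measure_negligible_finite_Union)
    show "pairwise (\<lambda>S T. negligible (S \<inter> T)) {T \<in> \<T>. \<nu> \<in> T}"
    proof (rule pairwiseI)
      fix S T assume "S \<in> {T \<in> \<T>. \<nu> \<in> T}" "T \<in> {T \<in> \<T>. \<nu> \<in> T}" "S \<noteq> T"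
      then have "S \<inter> T \<subseteq> frontier S"
        using interior_unique[of S T] closure_subset[of S] by (auto simp: frontier_def)
      then show "negligible (S \<inter> T)"
        using negligible_subset negligible_convex_frontier convex_member \<open>S \<in> _\<close> by blast
    qed
  qed (use finite_partition compact_member in \<open>auto intro: lmeasurable_compact\<close>)
  also have "\<dots> = (\<Sum>T\<in>{T \<in> \<T>. \<nu> \<in> T}. measure lborel T)"
    by (intro sum.cong refl measure_completion) (auto intro: borel_compact compact_member)
  finally show ?thesis
    by (simp add: patch_def)
qed

section \<open>Biorthogonality, support and norms for one partition\<close>

lemma integrable_products:
  assumes "\<nu> \<in> N" "\<nu>' \<in> N"
  shows "set_integrable lebesgue \<Omega> (\<lambda>x. \<phi> \<nu> x * \<phi> \<nu>' x)"
    and "set_integrable lebesgue \<Omega> (\<lambda>x. \<psi> \<nu> x * \<phi> \<nu>' x)"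
    and "set_integrable lebesgue \<Omega> (\<lambda>x. \<phi> \<nu> x * \<psi> \<nu>' x)"
    and "set_integrable lebesgue \<Omega> (\<lambda>x. \<psi> \<nu> x * \<psi> \<nu>' x)"
  by (rule set_integrable_mult_bounded[OF domain_measurable];
      use assms closure_subset in \<open>blast intro: phi_measurable psi_measurable abs_phi_le abs_psi_le\<close>)+

text \<open>Each simplex at \<open>\<nu>\<close> contributes its volume over \<open>d + 1\<close>,
  with \<open>d\<close> the dimension, times the value of \<open>\<phi> \<nu>'\<close> at
  \<open>\<nu>\<close>; all others contribute 0. The volumes add up to that of the patch.\<close>

lemma L2_inner_psi_phi:
  assumes "\<nu> \<in> N" "\<nu>' \<in> N"
  shows "L2_inner \<Omega> (\<psi> \<nu>) (\<phi> \<nu>') =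
    of_bool (\<nu> = \<nu>') * (1 / real (DIM('a) + 1)) * measure lebesgue (patch \<T> \<nu>)"
proof -
  have phi_nu: "\<phi> \<nu>' \<nu> = of_bool (\<nu> = \<nu>')"
    using nodal assms by (auto simp: nodal_basis_def)
  have piece: "(LINT x:interior T|lebesgue. \<psi> \<nu> x * \<phi> \<nu>' x) =
      (if \<nu> \<in> T then of_bool (\<nu> = \<nu>') * measure lborel T / (DIM('a) + 1) else 0)"
    if T: "T \<in> \<T>" for T
  proof (cases "\<nu> \<in> T")
    case True
    obtain W a b where piece: "nodal_piece T \<nu> W a b"
      using nodal_piece_exists[OF assms(1) T True] .
    obtain a' b' where ab': "\<And>x. x \<in> T \<Longrightarrow> \<phi> \<nu>' x = a' \<bullet> x + b'"
      using phi_affine[OF assms(2) T] by blast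
    let ?g = "\<lambda>x. (a \<bullet> x + b + 2 ^ (DIM('a) + 2) / real (DIM('a) + 2) *
      (2 ^ DIM('a) * indicator (homothety \<nu> (1/4) ` T) x - indicator (homothety \<nu> (1/2) ` T) x))
        * (a' \<bullet> x + b')"
    have "(LINT x:interior T|lebesgue. \<psi> \<nu> x * \<phi> \<nu>' x) = (LINT x:interior T|lebesgue. ?g x)"
    proof (rule set_lebesgue_integral_cong, safe)
      fix x assume x: "x \<in> interior T"
      then have "x \<in> T"
        using interior_subset by blast
      then show "\<psi> \<nu> x * \<phi> \<nu>' x = ?g x"
        using piece psi_interior_eq[OF assms(1) T True x] ab' by (simp add: nodal_piece_def)
    qed auto
    also have "\<dots> = (LINT x:T|lborel. ?g x)"
    proof (rule integral_interior_eq_lborel[OF compact_member[OF T] convex_member[OF T]])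
      have [measurable]: "homothety \<nu> c ` T \<in> sets borel" for c
        by (intro borel_compact compact_homothety compact_member T)
      show "?g \<in> borel_measurable borel"
        by measurable
    qed
    also have "\<dots> = (a' \<bullet> \<nu> + b') * measure lborel T / (DIM('a) + 1)"
      using piece by (intro integral_cone_dual[of T \<nu> W a b a' b']) (auto simp: nodal_piece_def)
    also have "a' \<bullet> \<nu> + b' = of_bool (\<nu> = \<nu>')"
      using ab'[OF True] phi_nu by simp
    finally show ?thesis
      using True by simp
  next
    case False
    have "\<psi> \<nu> x = 0" if x: "x \<in> interior T" for x
    proof (rule psi_off_patch[OF assms(1)])
      show "x \<in> closure \<Omega>"
        using x T interior_member_subset closure_subset by blast
      show "x \<notin> patch \<T> \<nu>"
        using interior_unique[OF T _ x] False by (auto simp: patch_def)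
    qed
    then have "(LINT x:interior T|lebesgue. \<psi> \<nu> x * \<phi> \<nu>' x) = (LINT x:interior T|lebesgue. 0)"
      by (intro set_lebesgue_integral_cong) auto
    then show ?thesis
      using False by (simp add: set_lebesgue_integral_def)
  qed
  have "L2_inner \<Omega> (\<psi> \<nu>) (\<phi> \<nu>') = (\<Sum>T\<in>\<T>. LINT x:interior T|lebesgue. \<psi> \<nu> x * \<phi> \<nu>' x)"
    unfolding L2_inner_def by (rule set_integral_domain[OF integrable_products(2)[OF assms]])
  also have "\<dots> = (\<Sum>T\<in>\<T>. if \<nu> \<in> T then of_bool (\<nu> = \<nu>') * measure lborel T / (DIM('a) + 1) else 0)"
    by (intro sum.cong refl piece)
  also have "\<dots> = (\<Sum>T\<in>{T \<in> \<T>. \<nu> \<in> T}. of_bool (\<nu> = \<nu>') * measure lborel T / (DIM('a) + 1))"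
    by (rule sum.inter_filter[OF finite_partition, symmetric])
  also have "\<dots> = of_bool (\<nu> = \<nu>') * (1 / real (DIM('a) + 1)) * measure lebesgue (patch \<T> \<nu>)"
    unfolding measure_patch sum_distrib_left by (intro sum.cong) auto
  finally show ?thesis .
qed

lemma supp_psi:
  assumes "\<nu> \<in> N"
  shows "supp_on \<Omega> (\<psi> \<nu>) = patch \<T> \<nu>"
proof
  show "supp_on \<Omega> (\<psi> \<nu>) \<subseteq> patch \<T> \<nu>"
    unfolding supp_on_def
  proof (rule closure_minimal)
    show "{x \<in> \<Omega>. \<psi> \<nu> x \<noteq> 0} \<subseteq> patch \<T> \<nu>"
      using psi_off_patch[OF assms] closure_subset[of \<Omega>] by blast
  qed (rule compact_imp_closed[OF compact_patch])
  have "T \<subseteq> supp_on \<Omega> (\<psi> \<nu>)" if T: "T \<in> \<T>" "\<nu> \<in> T" for T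
  proof -
    obtain W a b where piece: "nodal_piece T \<nu> W a b"
      using nodal_piece_exists[OF assms T] .
    \<comment> \<open>The coordinate is 1 at \<open>\<nu>\<close> and 0 on the nonempty
      \<open>W\<close>, so it is not constant.\<close>
    have "a \<noteq> 0"
    proof
      assume "a = 0"
      then show False
        using piece by (auto simp: nodal_piece_def)
    qed
    define k where "k = (2 ^ (DIM('a) + 2) / real (DIM('a) + 2) :: real)"
    \<comment> \<open>\<open>i\<close> and \<open>j\<close> run through the possible values of the
      indicators of the quarter and half copies, so every zero of \<open>\<psi> \<nu>\<close> in the
      interior lies on one of these hyperplanes.\<close>
    define Z where "Z = (\<Union>i\<in>{0,1::real}. \<Union>j\<in>{0,1::real}. {x. a \<bullet> x = - b - k * (2 ^ DIM('a) * i - j)})"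
    have "negligible Z"
      unfolding Z_def using \<open>a \<noteq> 0\<close> by (intro negligible_Union) (auto intro!: negligible_hyperplane)
    have nz: "\<psi> \<nu> x \<noteq> 0" if x: "x \<in> interior T" "x \<notin> Z" for x
    proof
      assume 0: "\<psi> \<nu> x = 0"
      have "x \<in> T"
        using x(1) interior_subset by blast
      then have "\<phi> \<nu> x = a \<bullet> x + b"
        using piece by (simp add: nodal_piece_def)
      moreover have "\<psi> \<nu> x = \<phi> \<nu> x + k * (2 ^ DIM('a) * indicator (homothety \<nu> (1/4) ` T) x
          - indicator (homothety \<nu> (1/2) ` T) x)" (is "_ = _ + ?t")
        unfolding k_def by (rule psi_interior_eq[OF assms T x(1)])
      ultimately have "a \<bullet> x + b + ?t = 0"
        using 0 by (simp only:)
      then have "a \<bullet> x = - b - ?t"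
        by argo
      moreover have "indicat_real A x \<in> {0, 1}" for A
        by (auto simp: indicator_def)
      ultimately have "x \<in> Z"
        unfolding Z_def by (intro UN_I CollectI)
      with x(2) show False
        by simp
    qed
    \<comment> \<open>A nonempty open set is not negligible, so removing \<open>Z\<close> leaves a
      dense subset of the interior.\<close>
    have "interior T \<subseteq> closure (interior T - Z)"
    proof
      fix x assume x: "x \<in> interior T"
      show "x \<in> closure (interior T - Z)"
      proof (rule ccontr)
        assume "x \<notin> closure (interior T - Z)"
        then have ne: "interior T - closure (interior T - Z) \<noteq> {}"
          using x by blast
        have "interior T - closure (interior T - Z) \<subseteq> Z"
          using closure_subset[of "interior T - Z"] by blast
        then have "negligible (interior T - closure (interior T - Z))"
          by (rule negligible_subset[OF \<open>negligible Z\<close>])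
        moreover have "open (interior T - closure (interior T - Z))"
          by (intro open_Diff) auto
        ultimately show False
          using ne open_not_negligible by blast
      qed
    qed
    also have "closure (interior T - Z) \<subseteq> supp_on \<Omega> (\<psi> \<nu>)"
      unfolding supp_on_def using nz interior_member_subset[OF T(1)] by (intro closure_mono) blast
    finally have "closure (interior T) \<subseteq> supp_on \<Omega> (\<psi> \<nu>)"
      by (intro closure_minimal) (auto simp: supp_on_def)
    then show ?thesis
      using closure_interior_member[OF T(1)] by simp
  qed
  then show "patch \<T> \<nu> \<subseteq> supp_on \<Omega> (\<psi> \<nu>)"
    by (auto simp: patch_def)
qed

text \<open>Both functions vanish off the patch and are bounded by 1 and \<open>M\<close>
  respectively, so each norm costs a factor \<open>sqrt\<close> of the patch volume.\<close>

lemma L2_norm_phi_psi_bounds: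
  assumes "\<nu> \<in> N"
  defines "M \<equiv> 1 + 2 ^ (DIM('a) + 2) / real (DIM('a) + 2) * (2 ^ DIM('a) + 1)"
  shows "L2_norm \<Omega> (\<phi> \<nu>) * L2_norm \<Omega> (\<psi> \<nu>) \<le> M * measure lebesgue (patch \<T> \<nu>)"
    and "\<bar>L2_inner \<Omega> (\<phi> \<nu>) (\<psi> \<nu>)\<bar> \<le> L2_norm \<Omega> (\<phi> \<nu>) * L2_norm \<Omega> (\<psi> \<nu>)"
proof -
  have P: "patch \<T> \<nu> \<in> lmeasurable"
    by (intro lmeasurable_compact compact_patch)
  have cl: "x \<in> \<Omega> \<Longrightarrow> x \<in> closure \<Omega>" for x
    using closure_subset by blast
  have M: "M \<ge> 0"
    unfolding M_def by (intro add_nonneg_nonneg mult_nonneg_nonneg) auto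
  have "L2_norm \<Omega> (\<phi> \<nu>) \<le> 1 * sqrt (measure lebesgue (patch \<T> \<nu>))"
    using phi_off_patch[OF assms(1) cl] abs_phi_le[OF assms(1) cl]
    by (intro L2_norm_le_of_bounded domain_measurable P phi_measurable assms) auto
  moreover have "L2_norm \<Omega> (\<psi> \<nu>) \<le> M * sqrt (measure lebesgue (patch \<T> \<nu>))"
    using psi_off_patch[OF assms(1) cl] abs_psi_le[OF assms(1) cl] M unfolding M_def
    by (intro L2_norm_le_of_bounded domain_measurable P psi_measurable assms(1))
  moreover have "0 \<le> L2_norm \<Omega> u" for u
    unfolding L2_norm_def L2_inner_def set_lebesgue_integral_def
    by (intro real_sqrt_ge_zero integral_nonneg_AE) auto
  ultimately have "L2_norm \<Omega> (\<phi> \<nu>) * L2_norm \<Omega> (\<psi> \<nu>)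
      \<le> (1 * sqrt (measure lebesgue (patch \<T> \<nu>))) * (M * sqrt (measure lebesgue (patch \<T> \<nu>)))"
    by (intro mult_mono) auto
  then show "L2_norm \<Omega> (\<phi> \<nu>) * L2_norm \<Omega> (\<psi> \<nu>) \<le> M * measure lebesgue (patch \<T> \<nu>)"
    by (simp add: mult_ac)
  show "\<bar>L2_inner \<Omega> (\<phi> \<nu>) (\<psi> \<nu>)\<bar> \<le> L2_norm \<Omega> (\<phi> \<nu>) * L2_norm \<Omega> (\<psi> \<nu>)"
    by (intro L2_inner_Cauchy_Schwarz integrable_products assms(1))
qed

end

section \<open>Constants uniform over the family\<close>

theorem lemma5p10:
  fixes \<Omega> \<gamma> :: "'a::euclidean_space set"
    and \<TT> :: "'a set set set"
    and \<phi> :: "'a set set \<Rightarrow> 'a \<Rightarrow> 'a \<Rightarrow> real"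
  assumes "polytopal_domain \<Omega>"
    and "closed \<gamma>" and "\<gamma> \<subseteq> frontier \<Omega>"
    and "\<And>\<T>. \<T> \<in> \<TT> \<Longrightarrow> conforming_partition \<Omega> \<T>"
    and "uniformly_shape_regular \<TT>"
    and "DIM('a) = 1 \<Longrightarrow> neighbours_uniformly_comparable \<TT>"
    and "\<And>\<T>. \<T> \<in> \<TT> \<Longrightarrow> union_of_facets \<T> \<gamma>"
    and "\<And>\<T>. \<T> \<in> \<TT> \<Longrightarrow> nodal_basis \<Omega> \<gamma> \<T> (\<phi> \<T>)"
  shows "\<exists>c>0. \<exists>C>0. \<forall>\<T>\<in>\<TT>. \<forall>\<T>\<^sub>1 \<T>\<^sub>2. red_refinement \<T> \<T>\<^sub>1 \<longrightarrow> red_refinement \<T>\<^sub>1 \<T>\<^sub>2 \<longrightarrow>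
    (\<forall>\<nu>\<in>free_vertices \<gamma> \<T>. \<forall>\<nu>'\<in>free_vertices \<gamma> \<T>.
       c * (of_bool (\<nu> = \<nu>') * L2_norm \<Omega> (\<phi> \<T> \<nu>) * L2_norm \<Omega> (psi (\<phi> \<T>) \<T>\<^sub>1 \<T>\<^sub>2 \<nu>'))
         \<le> \<bar>L2_inner \<Omega> (\<phi> \<T> \<nu>) (psi (\<phi> \<T>) \<T>\<^sub>1 \<T>\<^sub>2 \<nu>')\<bar> \<and>
       \<bar>L2_inner \<Omega> (\<phi> \<T> \<nu>) (psi (\<phi> \<T>) \<T>\<^sub>1 \<T>\<^sub>2 \<nu>')\<bar>
         \<le> C * (of_bool (\<nu> = \<nu>') * L2_norm \<Omega> (\<phi> \<T> \<nu>) * L2_norm \<Omega> (psi (\<phi> \<T>) \<T>\<^sub>1 \<T>\<^sub>2 \<nu>'))) \<and>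
    (\<forall>\<nu>\<in>free_vertices \<gamma> \<T>. supp_on \<Omega> (psi (\<phi> \<T>) \<T>\<^sub>1 \<T>\<^sub>2 \<nu>) = patch \<T> \<nu>) \<and>
    (\<forall>\<nu>\<in>free_vertices \<gamma> \<T>. \<forall>\<nu>'\<in>free_vertices \<gamma> \<T>.
       L2_inner \<Omega> (psi (\<phi> \<T>) \<T>\<^sub>1 \<T>\<^sub>2 \<nu>) (\<phi> \<T> \<nu>')
         = of_bool (\<nu> = \<nu>') * (1 / real (DIM('a) + 1)) * measure lebesgue (patch \<T> \<nu>))"
proof -
  define M where "M = 1 + 2 ^ (DIM('a) + 2) / real (DIM('a) + 2) * (2 ^ DIM('a) + 1)"
  \<comment> \<open>On the diagonal the inner product is the patch volume over
    \<open>DIM('a) + 1\<close>, while the product of norms is at most \<open>M\<close> times that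
    volume; \<open>c\<close> is the resulting ratio.\<close>
  define c where "c = 1 / (M * real (DIM('a) + 1))"
  have M: "M > 0"
    unfolding M_def by (intro add_pos_nonneg mult_nonneg_nonneg) auto
  have c: "c > 0"
    using M by (simp add: c_def)
  have two_sided: "c * (of_bool (\<nu> = \<nu>') * L2_norm \<Omega> (\<phi> \<T> \<nu>) * L2_norm \<Omega> (psi (\<phi> \<T>) \<T>\<^sub>1 \<T>\<^sub>2 \<nu>'))
         \<le> \<bar>L2_inner \<Omega> (\<phi> \<T> \<nu>) (psi (\<phi> \<T>) \<T>\<^sub>1 \<T>\<^sub>2 \<nu>')\<bar> \<and>
       \<bar>L2_inner \<Omega> (\<phi> \<T> \<nu>) (psi (\<phi> \<T>) \<T>\<^sub>1 \<T>\<^sub>2 \<nu>')\<bar>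
         \<le> 1 * (of_bool (\<nu> = \<nu>') * L2_norm \<Omega> (\<phi> \<T> \<nu>) * L2_norm \<Omega> (psi (\<phi> \<T>) \<T>\<^sub>1 \<T>\<^sub>2 \<nu>'))"
    if basis: "refined_nodal_basis \<Omega> \<gamma> \<T> \<T>\<^sub>1 \<T>\<^sub>2 (\<phi> \<T>)"
      and \<nu>: "\<nu> \<in> free_vertices \<gamma> \<T>" "\<nu>' \<in> free_vertices \<gamma> \<T>" for \<T> \<T>\<^sub>1 \<T>\<^sub>2 \<nu> \<nu>'
  proof -
    interpret refined_nodal_basis \<Omega> \<gamma> \<T> \<T>\<^sub>1 \<T>\<^sub>2 "\<phi> \<T>"
      by (rule basis)
    have inner: "L2_inner \<Omega> (\<phi> \<T> \<nu>) (\<psi> \<nu>') =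
        of_bool (\<nu>' = \<nu>) * (1 / real (DIM('a) + 1)) * measure lebesgue (patch \<T> \<nu>')"
      using L2_inner_psi_phi[OF \<nu>(2,1)] by (simp add: L2_inner_def mult.commute)
    show ?thesis
    proof (cases "\<nu> = \<nu>'")
      case True
      have "c * (L2_norm \<Omega> (\<phi> \<T> \<nu>) * L2_norm \<Omega> (\<psi> \<nu>)) \<le> c * (M * measure lebesgue (patch \<T> \<nu>))"
        using c L2_norm_phi_psi_bounds(1)[OF \<nu>(1)] unfolding M_def by (intro mult_left_mono) auto
      also have "\<dots> = \<bar>L2_inner \<Omega> (\<phi> \<T> \<nu>) (\<psi> \<nu>)\<bar>"
        using M inner True by (simp add: c_def)
      finally show ?thesis
        using L2_norm_phi_psi_bounds(2)[OF \<nu>(1)] True by simp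
    next
      case False
      then show ?thesis
        using inner by simp
    qed
  qed
  show ?thesis
  \<comment> \<open>The upper constant is 1 by the Cauchy-Schwarz inequality; off the diagonal both
    sides vanish.\<close>
  proof (rule exI[of _ c], rule conjI[OF c], rule exI[of _ 1], intro conjI zero_less_one ballI allI impI)
    fix \<T> \<T>\<^sub>1 \<T>\<^sub>2
    assume "\<T> \<in> \<TT>" "red_refinement \<T> \<T>\<^sub>1" "red_refinement \<T>\<^sub>1 \<T>\<^sub>2"
    then have basis: "refined_nodal_basis \<Omega> \<gamma> \<T> \<T>\<^sub>1 \<T>\<^sub>2 (\<phi> \<T>)"
      using assms by (intro refined_nodal_basis.intro) auto
    fix \<nu> assume \<nu>: "\<nu> \<in> free_vertices \<gamma> \<T>"
    show "supp_on \<Omega> (psi (\<phi> \<T>) \<T>\<^sub>1 \<T>\<^sub>2 \<nu>) = patch \<T> \<nu>"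
      by (rule refined_nodal_basis.supp_psi[OF basis \<nu>])
    fix \<nu>' assume \<nu>': "\<nu>' \<in> free_vertices \<gamma> \<T>"
    note two_sided[OF basis \<nu> \<nu>']
    then show "c * (of_bool (\<nu> = \<nu>') * L2_norm \<Omega> (\<phi> \<T> \<nu>) * L2_norm \<Omega> (psi (\<phi> \<T>) \<T>\<^sub>1 \<T>\<^sub>2 \<nu>'))
         \<le> \<bar>L2_inner \<Omega> (\<phi> \<T> \<nu>) (psi (\<phi> \<T>) \<T>\<^sub>1 \<T>\<^sub>2 \<nu>')\<bar>"
      and "\<bar>L2_inner \<Omega> (\<phi> \<T> \<nu>) (psi (\<phi> \<T>) \<T>\<^sub>1 \<T>\<^sub>2 \<nu>')\<bar>
         \<le> 1 * (of_bool (\<nu> = \<nu>') * L2_norm \<Omega> (\<phi> \<T> \<nu>) * L2_norm \<Omega> (psi (\<phi> \<T>) \<T>\<^sub>1 \<T>\<^sub>2 \<nu>'))"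
      by blast+
    show "L2_inner \<Omega> (psi (\<phi> \<T>) \<T>\<^sub>1 \<T>\<^sub>2 \<nu>) (\<phi> \<T> \<nu>')
         = of_bool (\<nu> = \<nu>') * (1 / real (DIM('a) + 1)) * measure lebesgue (patch \<T> \<nu>)"
      by (rule refined_nodal_basis.L2_inner_psi_phi[OF basis \<nu> \<nu>'])
  qed
qed

end
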